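(* Let $q\ge5$ be a prime power. If $q\not\equiv0\pmod3$, no $2_{\mathcal C}$-plane contains a real axis or an imaginary axis (so $\Lambda_{\mathrm{RA},2_{\mathcal C}}=\Pi_{2_{\mathcal C},\mathrm{RA}}=\Lambda_{\mathrm{IA},2_{\mathcal C}}=\Pi_{2_{\mathcal C},\mathrm{IA}}=0$). For every $q\ge5$, $\Lambda_{\mathrm{En}\Gamma,2_{\mathcal C}}=(q-1)^2$ and $\Pi_{2_{\mathcal C},\mathrm{En}\Gamma}=1$.
   Context: Let $\mathrm{PG}(3,q)$ have points $\mathbf{P}(x_0,x_1,x_2,x_3)$; put $P(t)=\mathbf{P}(t^3,t^2,t,1)$ ($t\in\mathbb{F}_q$), $P(\infty)=\mathbf{P}(1,0,0,0)$, $\mathcal{C}=\{P(t):t\in\mathbb{F}_q\cup\{\infty\}\}$ the twisted cubic and $G_q$ the group of projectivities fixing $\mathcal C$. Write $\boldsymbol{\pi}(c_0,c_1,c_2,c_3)$ for the plane $c_0x_0+c_1x_1+c_2x_2+c_3x_3=0$. The $\Gamma$-planes are the osculating planes $\boldsymbol{\pi}(1,-3t,3t^2,-t^3)$ ($t\in\mathbb{F}_q$) and $\boldsymbol{\pi}(0,0,0,1)$. A $2_{\mathcal C}$-plane is a plane containing exactly $2$ points of $\mathcal C$ (for $q\ge 5$ these form a $G_q$-orbit). For $q\not\equiv0\pmod3$: a real axis is the intersection line of two distinct $\Gamma$-planes; an imaginary axis is the line of $\mathrm{PG}(3,q)$ obtained as intersection of $\boldsymbol{\pi}(1,-3s,3s^2,-s^3)$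 and $\boldsymbol{\pi}(1,-3s^q,3s^{2q},-s^{3q})$, $s\in\mathbb{F}_{q^2}\setminus\mathbb{F}_q$. An imaginary chord is the line joining $P(s),P(s^q)$, $s\in\mathbb{F}_{q^2}\setminus\mathbb{F}_q$. An En$\Gamma$-line is a line containing no point of $\mathcal C$, lying in no $\Gamma$-plane, which is neither an imaginary chord nor (for $q\not\equiv 0\pmod3$) an imaginary axis. Notation: $\Lambda_{\lambda,\pi}$ is the number of $\lambda$-lines in a $\pi$-plane; $\Pi_{\pi,\lambda}$ is the average, over all $\lambda$-lines, of the number of $\pi$-planes through the line. *)

theory Defs
  imports "HOL-Analysis.Analysis" "HOL-Algebra.Algebraic_Closure_Type"
begin

text \<open>
  A finite field of order \<open>q\<close> is a type \<open>'a\<close> of class \<open>{field, finite}\<close> with \<open>CARD('a) = q\<close>.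
  Points, lines and planes of \<open>PG(3,q)\<close> are the 1-, 2- and 3-dimensional subspaces of \<open>'a ^ 4\<close>
  (as sets of vectors), and incidence is inclusion. The projective coordinates
  \<open>x\<^sub>0, x\<^sub>1, x\<^sub>2, x\<^sub>3\<close> are the components \<open>x $ 1, x $ 2, x $ 3, x $ 4\<close>.
\<close>

definition proj_point :: "'a::field ^ 4 \<Rightarrow> ('a ^ 4) set" where
  "proj_point x = vec.span {x}"

definition proj_lines :: "('a::field ^ 4) set set" where
  "proj_lines = {l. vec.subspace l \<and> vec.dim l = 2}"

definition plane :: "'a::field ^ 4 \<Rightarrow> ('a ^ 4) set" where
  "plane c = {x. (\<Sum>i\<in>UNIV. c $ i * x $ i) = 0}"

definition proj_planes :: "('a::field ^ 4) set set" where
  "proj_planes = {plane c | c. c \<noteq> 0}"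

definition cubic_vec :: "'a::field \<Rightarrow> 'a ^ 4" where
  "cubic_vec t = vector [t ^ 3, t ^ 2, t, 1]"

definition twisted_cubic :: "('a::field ^ 4) set set" where
  "twisted_cubic = insert (proj_point (vector [1, 0, 0, 0])) (range (\<lambda>t. proj_point (cubic_vec t)))"

definition osc_vec :: "'a::field \<Rightarrow> 'a ^ 4" where
  "osc_vec t = vector [1, - 3 * t, 3 * t ^ 2, - (t ^ 3)]"

definition Gamma_planes :: "('a::field ^ 4) set set" where
  "Gamma_planes = insert (plane (vector [0, 0, 0, 1])) (range (\<lambda>t. plane (osc_vec t)))"

definition two_C_planes :: "('a::field ^ 4) set set" where
  "two_C_planes = {p \<in> proj_planes. card {P \<in> twisted_cubic. P \<subseteq> p} = 2}"

text \<open>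
  The field with \<open>q\<^sup>2\<close> elements is realised inside the algebraic closure of \<open>'a\<close>, as the set of
  solutions of \<open>s ^ (q\<^sup>2) = s\<close>; the base field is the range of \<^const>\<open>to_ac\<close>.
\<close>

definition quad_ext_nonbase :: "'a::{field, finite} alg_closure set" where
  "quad_ext_nonbase = {s. s ^ (CARD('a) ^ 2) = s} - range to_ac"

definition lift_vec :: "'a::field ^ 4 \<Rightarrow> 'a alg_closure ^ 4" where
  "lift_vec x = (\<chi> i. to_ac (x $ i))"

definition real_axes :: "('a::field ^ 4) set set" where
  "real_axes = {p1 \<inter> p2 | p1 p2. p1 \<in> Gamma_planes \<and> p2 \<in> Gamma_planes \<and> p1 \<noteq> p2}"

text \<open>
  A line over the extension field that is fixed by conjugation is, as a line of \<open>PG(3,q)\<close>,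
  the set of its vectors with coordinates in \<open>'a\<close>. For this set it makes no
  difference whether the span below is taken over the quadratic extension or over the
  whole algebraic closure.
\<close>

definition imaginary_axes :: "('a::{field, finite} ^ 4) set set" where
  "imaginary_axes =
    {{x. lift_vec x \<in> plane (osc_vec s) \<inter> plane (osc_vec (s ^ CARD('a)))} | s. s \<in> quad_ext_nonbase}"

definition imaginary_chords :: "('a::{field, finite} ^ 4) set set" where
  "imaginary_chords =
    {{x. lift_vec x \<in> vec.span {cubic_vec s, cubic_vec (s ^ CARD('a))}} | s. s \<in> quad_ext_nonbase}"

definition EnGamma_lines :: "('a::{field, finite} ^ 4) set set" where
  "EnGamma_lines = {l \<in> proj_lines.
     (\<forall>P\<in>twisted_cubic. \<not> P \<subseteq> l) \<and> (\<forall>p\<in>Gamma_planes. \<not> l \<subseteq> p) \<and>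
     l \<notin> imaginary_chords \<and> (CARD('a) mod 3 \<noteq> 0 \<longrightarrow> l \<notin> imaginary_axes)}"

text \<open>
  \<open>Lambda_num L p\<close> counts the lines of the class \<open>L\<close> lying in one plane \<open>p\<close>; the number
  \<open>\<Lambda>\<close> for a class of planes equals \<open>n\<close> if \<open>Lambda_num L p = n\<close> for every plane \<open>p\<close> of the class.
\<close>

definition Lambda_num :: "('a::field ^ 4) set set \<Rightarrow> ('a ^ 4) set \<Rightarrow> nat" where
  "Lambda_num L p = card {l \<in> L. l \<subseteq> p}"

definition Pi_avg :: "('a::field ^ 4) set set \<Rightarrow> ('a ^ 4) set set \<Rightarrow> real" where
  "Pi_avg \<pi> L = (\<Sum>l\<in>L. real (card {p \<in> \<pi>. l \<subseteq> p})) / real (card L)"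

end

(*
  A plane with coefficient vector c corresponds to the binary cubic form cutting out its points on
  the twisted cubic. The planes meeting the cubic in exactly two points a, b are those whose form is
  L_a^2 L_b up to a factor, for an ordered pair of distinct parameters. The polar forms of
  L_a^2 L_b show that no axis, real or imaginary, lies in such a plane.

  Of the q^2 + q + 1 lines in the plane, 2 q + 1 pass through P(a) or P(b); the intersections with the
  q - 1 osculating planes at the remaining points are distinct, as no real axis lies in the plane;
  and imaginary chords are excluded because the form has no conjugate roots. This leaves (q - 1)^2.
  For the average, the En Gamma-lines are counted by removing from all lines those meeting the cubic,
  those in an osculating plane, the imaginary chords and the imaginary axes. The points and osculating
  planes (and the roots of x^2 - m x + n, for the number of irreducible quadratics) give families of
  sets that meet pairwise in one element and have no element in three members; only in
  characteristic 3 do the osculating planes instead share a common line.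
*)
theory Submission
  imports Defs "HOL-Number_Theory.Residues" "HOL-Algebra.Sylow"
begin

section \<open>Inclusion-exclusion for pairs, and the Frobenius map of a finite field\<close>

text \<open>Inclusion-exclusion stops after the pair terms, which are all 1. A new member meets the
  union of the earlier ones in \<open>card I\<close> elements, because its intersections with them
  are disjoint singletons. The additive form avoids truncated subtraction.\<close>

lemma card_UN_pairs:
  assumes "finite I" "\<And>i. i \<in> I \<Longrightarrow> finite (A i)"
    and "\<And>i j. i \<in> I \<Longrightarrow> j \<in> I \<Longrightarrow> i \<noteq> j \<Longrightarrow> card (A i \<inter> A j) = 1"
    and "\<And>i j k. i \<in> I \<Longrightarrow> j \<in> I \<Longrightarrow> k \<in> I \<Longrightarrow> i \<noteq> j \<Longrightarrow> i \<noteq> k \<Longrightarrow> j \<noteq> k \<Longrightarrow>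
           A i \<inter> A j \<inter> A k = {}"
  shows "card (\<Union>i\<in>I. A i) + (card I choose 2) = (\<Sum>i\<in>I. card (A i))"
  using assms
proof (induction I rule: finite_induct)
  case empty
  then show ?case by simp
next
  case (insert i I)
  note fin = insert.prems(1) and one = insert.prems(2) and none = insert.prems(3)
  have IH: "card (\<Union>j\<in>I. A j) + (card I choose 2) = (\<Sum>j\<in>I. card (A j))"
    by (rule insert.IH; (rule fin one none)?; blast)
  have "card (A i \<inter> (\<Union>j\<in>I. A j)) = card (\<Union>j\<in>I. A i \<inter> A j)"
    by (simp only: Int_UN_distrib)
  also have "\<dots> = (\<Sum>j\<in>I. card (A i \<inter> A j))"
  proof (intro card_UN_disjoint ballI impI)
    show "finite I" by (rule insert.hyps)
    show "finite (A i \<inter> A j)" if "j \<in> I" for j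
      by (rule finite_Int) (simp add: fin)
  next
    fix j k assume "j \<in> I" "k \<in> I" "j \<noteq> k"
    then have "A i \<inter> A j \<inter> A k = {}"
      using insert.hyps(2) by (intro none) auto
    then show "A i \<inter> A j \<inter> (A i \<inter> A k) = {}"
      by blast
  qed
  also have "\<dots> = (\<Sum>j\<in>I. 1)"
    using insert.hyps(2) by (intro sum.cong refl one) auto
  finally have inter: "card (A i \<inter> (\<Union>j\<in>I. A j)) = card I"
    by simp
  have "finite (A i)" "finite (\<Union>j\<in>I. A j)"
    using insert.hyps(1) by (auto intro!: fin)
  from card_Un_Int[OF this] have "card (A i \<union> (\<Union>j\<in>I. A j)) + card I =
      card (A i) + card (\<Union>j\<in>I. A j)"
    unfolding inter by simp
  moreover have "Suc (card I) choose 2 = card I + (card I choose 2)"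
    by (simp add: numeral_2_eq_2)
  moreover have "(\<Union>j\<in>insert i I. A j) = A i \<union> (\<Union>j\<in>I. A j)"
    by (rule UN_insert)
  ultimately show ?case
    using IH by (simp only: card_insert_disjoint[OF insert.hyps] sum.insert[OF insert.hyps])
qed

lemma one_less_CARD_field: "1 < CARD('a::{field, finite})"
  using card_mono[of UNIV "{0, 1 :: 'a}"] by simp

text \<open>
  By Sylow's theorem a prime \<open>r\<close> dividing the order of the field yields a non-zero element of
  additive order a power of \<open>r\<close>, so \<open>r\<close> is the characteristic.
\<close>

lemma exists_prime_power_CARD:
  "\<exists>n. CARD('a::{field, finite}) = CHAR('a) ^ n"
proof -
  have pr: "Factorial_Ring.prime (CHAR('a))"
    by (intro prime_CHAR_semidom finite_imp_CHAR_pos) simp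
  have only: "r = CHAR('a)" if r: "Factorial_Ring.prime r" "r dvd CARD('a)" for r
  proof -
    define G where "G = \<lparr>carrier = (UNIV :: 'a set), monoid.mult = (+), one = (0 :: 'a)\<rparr>"
    interpret G: group G
    proof (rule groupI)
      fix x assume "x \<in> carrier G"
      show "\<exists>y\<in>carrier G. y \<otimes>\<^bsub>G\<^esub> x = \<one>\<^bsub>G\<^esub>"
        by (intro bexI[of _ "- x"]) (auto simp: G_def)
    qed (auto simp: G_def add_ac)
    have pow: "x [^]\<^bsub>G\<^esub> k = of_nat k * x" for x and k :: nat
      by (induction k) (auto simp: G_def nat_pow_def algebra_simps)
    define a where "a = multiplicity r (CARD('a))"
    obtain m where m: "CARD('a) = r ^ a * m"
      using multiplicity_dvd[of r "CARD('a)"] unfolding a_def by (elim dvdE)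
    have "a > 0"
      using r by (simp add: a_def prime_multiplicity_gt_zero_iff)
    obtain H where H: "subgroup H G" "card H = r ^ a"
      using sylow_thm[of r G a m] r(1) G.is_group m by (auto simp: order_def G_def)
    have "card H > 1"
      unfolding H(2) using prime_gt_1_nat[OF r(1)] \<open>a > 0\<close> by (rule one_less_power)
    then have "\<not> H \<subseteq> {0}"
      using card_mono[of "{0 :: 'a}" H] by auto
    then obtain x where x: "x \<in> H" "x \<noteq> 0"
      by auto
    interpret H: group "G\<lparr>carrier := H\<rparr>"
      using H(1) G.is_group by (rule subgroup.subgroup_is_group)
    have "x [^]\<^bsub>G\<lparr>carrier := H\<rparr>\<^esub> (r ^ a) = \<one>\<^bsub>G\<lparr>carrier := H\<rparr>\<^esub>"
      using H.pow_order_eq_1[of x] x H(2) by (simp add: order_def)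
    then have "of_nat (r ^ a) * x = 0"
      using pow[of x "r ^ a"] by (simp add: nat_pow_def G_def)
    then have "of_nat (r ^ a) = (0 :: 'a)"
      using x by simp
    then have "CHAR('a) dvd r ^ a"
      by (simp only: of_nat_eq_0_iff_char_dvd)
    then have "CHAR('a) dvd r"
      by (rule prime_dvd_power[OF pr])
    then show ?thesis
      using primes_dvd_imp_eq[OF pr r(1)] by simp
  qed
  define k where "k = multiplicity (CHAR('a)) (CARD('a))"
  obtain m where m: "CARD('a) = CHAR('a) ^ k * m"
    using multiplicity_dvd[of "CHAR('a)" "CARD('a)"] unfolding k_def by (elim dvdE)
  have "\<not> CHAR('a) dvd m"
  proof
    assume "CHAR('a) dvd m"
    then have "CHAR('a) ^ Suc k dvd CARD('a)"
      using m by (simp add: mult.commute)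
    then have "Suc k \<le> k"
      unfolding k_def using pr by (intro multiplicity_geI) auto
    then show False
      by simp
  qed
  moreover have "CHAR('a) dvd m" if m1: "m \<noteq> 1"
  proof -
    obtain r where "Factorial_Ring.prime r" "r dvd m"
      using prime_factor_nat[OF m1] by auto
    then show ?thesis
      using only[of r] m by simp
  qed
  ultimately have "m = 1"
    by auto
  then show ?thesis
    using m by auto
qed

text \<open>The characteristic is the only prime dividing the order. This links the residue
  condition in \<open>EnGamma_lines\<close> to the invertibility of 3 in coordinate
  computations.\<close>

lemma three_eq_0_iff: "(3 :: 'a::{field, finite}) = 0 \<longleftrightarrow> CARD('a) mod 3 = 0"
proof -
  have pr: "Factorial_Ring.prime (CHAR('a))"
    by (intro prime_CHAR_semidom finite_imp_CHAR_pos) simp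
  have pr3: "Factorial_Ring.prime (3 :: nat)"
    by simp
  have "(3 :: 'a) = 0 \<longleftrightarrow> CHAR('a) dvd 3"
    using of_nat_eq_0_iff_char_dvd[where ?'a = 'a, of 3] by simp
  also have "\<dots> \<longleftrightarrow> CHAR('a) = 3"
    using primes_dvd_imp_eq[OF pr pr3] by auto
  also have "\<dots> \<longleftrightarrow> 3 dvd CARD('a)"
  proof
    assume "CHAR('a) = 3"
    then show "3 dvd CARD('a)"
      using CHAR_dvd_CARD[where ?'a = 'a] by simp
  next
    assume "3 dvd CARD('a)"
    then have "3 dvd CHAR('a)"
      using exists_prime_power_CARD[where ?'a = 'a] prime_dvd_power[OF pr3] by metis
    then show "CHAR('a) = 3"
      using primes_dvd_imp_eq[OF pr3 pr] by simp
  qed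
  finally show ?thesis
    by (simp add: dvd_eq_mod_eq_0)
qed

text \<open>Multiplication by a non-zero \<open>x\<close> permutes the non-zero elements; comparing
  their product before and after gives \<open>x ^ (CARD('a) - 1) = 1\<close>.\<close>

lemma power_CARD_eq_same: "(x :: 'a::{field, finite}) ^ CARD('a) = x"
proof (cases "x = 0")
  case False
  have "bij_betw ((*) x) (UNIV - {0}) (UNIV - {0})"
    by (rule bij_betwI[of _ _ _ "\<lambda>y. y / x"]) (use False in auto)
  then have "(\<Prod>y\<in>UNIV - {0}. x * y) = \<Prod>(UNIV - {0})"
    by (rule prod.reindex_bij_betw)
  then have "x ^ (CARD('a) - 1) = 1"
    by (simp add: prod.distrib)
  then show ?thesis
    using power_minus_mult[of "CARD('a)" x] by simp
qed simp

text \<open>The exponent is a power of the characteristic, so this is an iterate of the Frobenius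
  endomorphism.\<close>

lemma power_CARD_add:
  fixes x y :: "'a::{field, finite} alg_closure"
  shows "(x + y) ^ CARD('a) = x ^ CARD('a) + y ^ CARD('a)"
proof -
  obtain n where "CARD('a) = CHAR('a alg_closure) ^ n"
    using exists_prime_power_CARD[where ?'a = 'a] by auto
  moreover have "Factorial_Ring.prime (CHAR('a alg_closure))"
    using prime_CHAR_semidom[where ?'a = 'a] finite_imp_CHAR_pos[where ?'a = 'a] by simp
  ultimately show ?thesis
    by (rule freshmans_dream'[rotated])
qed

text \<open>The polynomial X^q - X has at most q roots, and the base field already supplies q of
  them. Membership in the base field thus becomes invariance under Frobenius.\<close>

lemma range_to_ac_eq:
  "range (to_ac :: 'a::{field, finite} \<Rightarrow> 'a alg_closure) = {x. x ^ CARD('a) = x}"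
proof (rule card_seteq)
  have q: "CARD('a) > 1"
    by (rule one_less_CARD_field)
  define p :: "'a alg_closure poly" where "p = Polynomial.monom 1 (CARD('a)) - [:0, 1:]"
  have p: "poly p x = x ^ CARD('a) - x" for x
    by (simp add: p_def poly_monom)
  have deg: "Polynomial.degree p = CARD('a)"
    unfolding p_def using q
      by (subst diff_conv_add_uminus, subst degree_add_eq_left) (auto simp: degree_monom_eq)
  then have "p \<noteq> 0"
    using q by auto
  have eq: "{x :: 'a alg_closure. x ^ CARD('a) = x} = {x. poly p x = 0}"
    by (auto simp: p)
  show "finite {x :: 'a alg_closure. x ^ CARD('a) = x}"
    unfolding eq by (rule poly_roots_finite) fact
  have "card {x. poly p x = 0} \<le> Polynomial.degree p"
    by (rule card_poly_roots_bound) fact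
  then show "card {x :: 'a alg_closure. x ^ CARD('a) = x} \<le> card (range (to_ac :: 'a \<Rightarrow> _))"
    unfolding eq by (simp add: deg card_image inj_to_ac)
  show "range (to_ac :: 'a \<Rightarrow> _) \<subseteq> {x. x ^ CARD('a) = x}"
    using power_CARD_eq_same[where ?'a = 'a] by (auto simp flip: to_ac_power)
qed

section \<open>Counting lines of the projective space\<close>

text \<open>Each vector of the larger span is \<open>k *s v + x\<close> for a unique scalar
  \<open>k\<close> and a unique \<open>x\<close> in the old span; two different scalars would put
  \<open>v\<close> into the old span.\<close>

lemma card_span_insert:
  fixes S :: "('a::{field, finite} ^ 'n) set"
  assumes "v \<notin> vec.span S"
  shows "card (vec.span (insert v S)) = CARD('a) * card (vec.span S)"
proof -
  have "bij_betw (\<lambda>(k :: 'a, x). k *s v + x) (UNIV \<times> vec.span S) (vec.span (insert v S))"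
  proof (rule bij_betwI')
    fix y z assume "y \<in> (UNIV :: 'a set) \<times> vec.span S" "z \<in> (UNIV :: 'a set) \<times> vec.span S"
    then obtain k x l w where eq: "y = (k, x)" "z = (l, w)" "x \<in> vec.span S" "w \<in> vec.span S"
      by auto
    have "k = l \<and> x = w" if h: "k *s v + x = l *s v + w"
    proof -
      have "(k - l) *s v = w - x"
        using h by (simp add: vec.scale_left_diff_distrib algebra_simps)
      then have "(k - l) *s v \<in> vec.span S"
        using eq by (simp add: vec.span_diff)
      then have "k = l"
        using assms vec.span_scale[of "(k - l) *s v" S "inverse (k - l)"]
        by (cases "k = l") (simp_all only: vec.scale_scale, simp_all)
      with h show ?thesis by simp
    qed
    then show "((\<lambda>(k :: 'a, x). k *s v + x) y = (\<lambda>(k, x). k *s v + x) z) = (y = z)"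
      by (auto simp: eq)
  next
    fix y assume "y \<in> (UNIV :: 'a set) \<times> vec.span S"
    then show "(\<lambda>(k, x). k *s v + x) y \<in> vec.span (insert v S)"
      by (auto intro!: vec.span_add vec.span_scale intro: vec.span_base
          vec.span_mono[THEN subsetD, of S])
  next
    fix y assume "y \<in> vec.span (insert v S)"
    then obtain k where "y - k *s v \<in> vec.span S"
      by (auto simp: vec.span_insert)
    then show "\<exists>x\<in>(UNIV :: 'a set) \<times> vec.span S. y = (\<lambda>(k, x). k *s v + x) x"
      by (intro bexI[of _ "(k, y - k *s v)"]) auto
  qed
  from bij_betw_same_card[OF this] show ?thesis
    by (simp add: card_cartesian_product)
qed

lemma card_span_independent:
  fixes B :: "('a::{field, finite} ^ 'n) set"
  assumes "vec.independent B"
  shows "card (vec.span B) = CARD('a) ^ card B"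
  using finite[of B] assms
proof (induction B rule: finite_induct)
  case (insert v B)
  then show ?case
    using card_span_insert[of v B] by (simp add: vec.independent_insert)
qed simp

lemma card_subspace:
  fixes S :: "('a::{field, finite} ^ 'n) set"
  assumes "vec.subspace S"
  shows "card S = CARD('a) ^ vec.dim S"
proof -
  obtain B where B: "B \<subseteq> S" "vec.independent B" "S \<subseteq> vec.span B" "card B = vec.dim S"
    using vec.basis_exists[of S] by metis
  then have "vec.span B = S"
    using assms by (simp add: vec.span_subspace)
  then show ?thesis
    using B card_span_independent by metis
qed

text \<open>Trades dimension for size, so that later arguments recognise and compare lines by
  counting their vectors.\<close>

lemma proj_lines_iff:
  fixes l :: "('a::{field, finite} ^ 4) set"
  shows "l \<in> proj_lines \<longleftrightarrow> vec.subspace l \<and> card l = CARD('a) ^ 2"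
  using one_less_CARD_field[where ?'a = 'a]
  by (auto simp: proj_lines_def card_subspace)

lemma subspace_plane: "vec.subspace (plane c)"
  by (auto simp: vec.subspace_def plane_def sum.distrib distrib_left mult.left_commute
      simp flip: sum_distrib_left)

text \<open>A vector of \<open>S\<close> outside the plane splits each element of \<open>S\<close>
  uniquely into a multiple of that vector and an element of the plane.\<close>

lemma card_Int_plane:
  fixes S :: "('a::{field, finite} ^ 4) set"
  assumes S: "vec.subspace S" and "\<not> S \<subseteq> plane c"
  shows "CARD('a) * card (S \<inter> plane c) = card S"
proof -
  define f where "f = (\<lambda>x :: 'a ^ 4. \<Sum>i\<in>UNIV. c $ i * x $ i)"
  have f: "f (x + y) = f x + f y" "f (k *s x) = k * f x" for x y k
    by (auto simp: f_def sum.distrib distrib_left sum_distrib_left mult_ac)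
  have pl: "x \<in> plane c \<longleftrightarrow> f x = 0" for x
    by (simp add: plane_def f_def)
  obtain v where v: "v \<in> S" "f v \<noteq> 0"
    using assms(2) pl by blast
  have "bij_betw (\<lambda>(k :: 'a, x). k *s v + x) (UNIV \<times> (S \<inter> plane c)) S"
  proof (rule bij_betwI[where g = "\<lambda>x. (f x / f v, x - (f x / f v) *s v)"])
    show "(\<lambda>(k, x). k *s v + x) \<in> UNIV \<times> (S \<inter> plane c) \<rightarrow> S"
      using S v(1) by (auto intro!: vec.subspace_add vec.subspace_scale)
  next
    have "f (x - (f x / f v) *s v) = 0" for x
      using f(1)[of "x - (f x / f v) *s v" "(f x / f v) *s v"] v(2) by (simp add: f(2))
    then have "x - (f x / f v) *s v \<in> plane c" for x
      by (simp only: pl)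
    then show "(\<lambda>x. (f x / f v, x - (f x / f v) *s v)) \<in> S \<rightarrow> UNIV \<times> (S \<inter> plane c)"
      using vec.subspace_diff[OF S _ vec.subspace_scale[OF S v(1)]] by auto
  next
    fix y assume "y \<in> (UNIV :: 'a set) \<times> (S \<inter> plane c)"
    then show "(\<lambda>x. (f x / f v, x - (f x / f v) *s v)) ((\<lambda>(k, x). k *s v + x) y) = y"
      using v(2) by (auto simp: pl f add_divide_distrib)
  qed auto
  from bij_betw_same_card[OF this] show ?thesis
    by (simp add: card_cartesian_product)
qed

lemma card_plane:
  assumes "c \<noteq> 0"
  shows "card (plane c :: ('a::{field, finite} ^ 4) set) = CARD('a) ^ 3"
proof -
  obtain i where "c $ i \<noteq> 0"
    using assms by (auto simp: vec_eq_iff)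
  then have "axis i 1 \<notin> plane c"
    by (simp add: plane_def axis_def if_distrib cong: if_cong)
  then have "CARD('a) * card (UNIV \<inter> plane c) = card (UNIV :: ('a ^ 4) set)"
    by (intro card_Int_plane) auto
  also have "\<dots> = CARD('a) ^ 4"
    by simp
  also have "\<dots> = CARD('a) * CARD('a) ^ 3"
    by (simp flip: power_Suc)
  finally show ?thesis
    by simp
qed

lemma proj_line_eq_span:
  fixes l :: "('a::{field, finite} ^ 4) set"
  assumes "l \<in> proj_lines" "v \<in> l" "w \<in> l" "v \<noteq> 0" "w \<notin> vec.span {v}"
  shows "l = vec.span {v, w}"
proof -
  have "vec.span {v, w} \<subseteq> l"
    using assms by (intro vec.span_minimal) (auto simp: proj_lines_def)
  moreover have "card (vec.span {w, v}) = card l"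
    using assms card_span_insert[of w "{v}"] card_span_insert[of v "{}"]
    by (simp add: proj_lines_iff power2_eq_square)
  ultimately show ?thesis
    using card_subset_eq[of l "vec.span {v, w}"] by (simp add: insert_commute)
qed

lemma span_in_proj_lines:
  fixes v w :: "'a::{field, finite} ^ 4"
  assumes "v \<noteq> 0" "w \<notin> vec.span {v}"
  shows "vec.span {v, w} \<in> proj_lines"
  using assms card_span_insert[of w "{v}"] card_span_insert[of v "{}"]
  by (simp add: proj_lines_iff power2_eq_square insert_commute)

text \<open>With the multiples of \<open>v\<close> removed, the lines through \<open>v\<close>
  partition what remains of \<open>U\<close> into parts of size q^2 - q.\<close>

lemma card_lines_through:
  fixes U :: "('a::{field, finite} ^ 4) set"
  assumes U: "vec.subspace U" and v: "v \<in> U" "v \<noteq> 0"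
  shows "card {l \<in> proj_lines. v \<in> l \<and> l \<subseteq> U} * (CARD('a) ^ 2 - CARD('a)) = card U - CARD('a)"
proof -
  let ?L = "{l \<in> proj_lines. v \<in> l \<and> l \<subseteq> U}"
  have cv: "card (vec.span {v}) = CARD('a)"
    using card_span_insert[of v "{}"] v by simp
  have "U - vec.span {v} = (\<Union>l\<in>?L. l - vec.span {v})"
  proof (intro equalityI subsetI)
    fix w assume "w \<in> U - vec.span {v}"
    moreover have "vec.span {v, w} \<subseteq> U" "{v, w} \<subseteq> vec.span {v, w}"
      using v U \<open>w \<in> U - vec.span {v}\<close> vec.span_minimal[of "{v, w}" U]
      by (auto intro: vec.span_base)
    ultimately have "vec.span {v, w} \<in> ?L" "w \<in> vec.span {v, w} - vec.span {v}"
      using v span_in_proj_lines[of v w] by auto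
    then show "w \<in> (\<Union>l\<in>?L. l - vec.span {v})"
      by blast
  qed auto
  also have "card \<dots> = (\<Sum>l\<in>?L. card (l - vec.span {v}))"
  proof (intro card_UN_disjoint ballI impI)
    fix l m assume lm: "l \<in> ?L" "m \<in> ?L" "l \<noteq> m"
    then show "(l - vec.span {v}) \<inter> (m - vec.span {v}) = {}"
      using proj_line_eq_span[of l v] proj_line_eq_span[of m v] v
        by (smt (verit) CollectD DiffE disjoint_iff)
  qed auto
  also have "\<dots> = (\<Sum>l\<in>?L. CARD('a) ^ 2 - CARD('a))"
  proof (rule sum.cong)
    fix l assume "l \<in> ?L"
    then show "card (l - vec.span {v}) = CARD('a) ^ 2 - CARD('a)"
      by (subst card_Diff_subset)
        (auto simp: cv proj_lines_iff intro: vec.span_minimal[of "{v}" l, THEN subsetD])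
  qed simp
  finally show ?thesis
    using U v by (subst (asm) card_Diff_subset)
      (auto simp: cv intro: vec.span_minimal[of "{v}" U, THEN subsetD])
qed

text \<open>Double counting of the pairs of a line in \<open>U\<close> and a non-zero vector on it;
  each line carries q^2 - 1 such vectors.\<close>

lemma card_lines_within:
  fixes U :: "('a::{field, finite} ^ 4) set"
  assumes U: "vec.subspace U"
    and n: "\<And>v. v \<in> U \<Longrightarrow> v \<noteq> 0 \<Longrightarrow> card {l \<in> proj_lines. v \<in> l \<and> l \<subseteq> U} = n"
  shows "card {l \<in> proj_lines. l \<subseteq> U} * (CARD('a) ^ 2 - 1) = n * (card U - 1)"
proof -
  let ?L = "{l \<in> proj_lines. l \<subseteq> U}"
  have "(\<Sum>l\<in>?L. card {v \<in> U - {0}. v \<in> l}) = n * card (U - {0})"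
  proof (rule sum_multicount)
    have "{l \<in> ?L. v \<in> l} = {l \<in> proj_lines. v \<in> l \<and> l \<subseteq> U}" for v
      by auto
    then show "\<forall>v\<in>U - {0}. card {l \<in> ?L. v \<in> l} = n"
      using n by simp
  qed auto
  moreover have "card {v \<in> U - {0}. v \<in> l} = CARD('a) ^ 2 - 1" if "l \<in> ?L" for l
  proof -
    have "{v \<in> U - {0}. v \<in> l} = l - {0}" "0 \<in> l"
      using that by (auto simp: proj_lines_def vec.subspace_0)
    then show ?thesis
      using that by (simp add: proj_lines_iff)
  qed
  ultimately show ?thesis
    using vec.subspace_0[OF U] by simp
qed

lemma card_lines_through_in_plane:
  fixes v :: "'a::{field, finite} ^ 4"
  assumes "c \<noteq> 0" "v \<in> plane c" "v \<noteq> 0"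
  shows "card {l \<in> proj_lines. v \<in> l \<and> l \<subseteq> plane c} = CARD('a) + 1" (is "?N = _")
proof -
  let ?q = "CARD('a)"
  have nz: "?q ^ 2 - ?q \<noteq> 0"
    using one_less_CARD_field[where ?'a = 'a] by (simp add: power2_eq_square)
  have "?N * (?q ^ 2 - ?q) = ?q ^ 3 - ?q"
    using card_lines_through[OF subspace_plane assms(2,3)] card_plane[OF assms(1)] by simp
  also have "\<dots> = (?q + 1) * (?q ^ 2 - ?q)"
    by (simp add: diff_mult_distrib2 power2_eq_square power3_eq_cube add_mult_distrib)
  finally show ?thesis
    using nz by (simp only: mult_cancel_right simp_thms)
qed

lemma card_lines_in_plane:
  fixes c :: "'a::{field, finite} ^ 4"
  assumes "c \<noteq> 0"
  shows "card {l \<in> proj_lines. l \<subseteq> plane c} = CARD('a) ^ 2 + CARD('a) + 1" (is "?N = _")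
proof -
  let ?q = "CARD('a)"
  \<comment> \<open>With q written as a successor, the truncated subtractions become polynomial
    identities in \<open>r\<close>.\<close>
  obtain r where r: "?q = Suc r" "r > 0"
    using one_less_CARD_field[where ?'a = 'a] by (cases ?q) auto
  have nz: "?q ^ 2 - 1 \<noteq> 0"
    unfolding r using r(2) by (simp add: power2_eq_square)
  have "?N * (?q ^ 2 - 1) = (?q + 1) * (?q ^ 3 - 1)"
    using card_lines_within[OF subspace_plane[of c], of "?q + 1"]
      card_lines_through_in_plane[OF assms]
    by (simp add: card_plane[OF assms])
  also have "\<dots> = (?q ^ 2 + ?q + 1) * (?q ^ 2 - 1)"
    unfolding r by (simp add: algebra_simps power2_eq_square power3_eq_cube)
  finally show ?thesis
    using nz by (simp only: mult_cancel_right simp_thms)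
qed

lemma card_lines_through_point:
  fixes v :: "'a::{field, finite} ^ 4"
  assumes "v \<noteq> 0"
  shows "card {l \<in> proj_lines. v \<in> l} = CARD('a) ^ 2 + CARD('a) + 1" (is "?N = _")
proof -
  let ?q = "CARD('a)"
  have nz: "?q ^ 2 - ?q \<noteq> 0"
    using one_less_CARD_field[where ?'a = 'a] by (simp add: power2_eq_square)
  have "?N * (?q ^ 2 - ?q) = ?q ^ 4 - ?q"
    using card_lines_through[of UNIV v] assms by simp
  also have "\<dots> = (?q ^ 2 + ?q + 1) * (?q ^ 2 - ?q)"
    by (simp add: diff_mult_distrib2 power2_eq_square power4_eq_xxxx add_mult_distrib)
  finally show ?thesis
    using nz by (simp only: mult_cancel_right simp_thms)
qed

lemma card_proj_lines:
  "card (proj_lines :: ('a::{field, finite} ^ 4) set set) =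
    (CARD('a) ^ 2 + 1) * (CARD('a) ^ 2 + CARD('a) + 1)" (is "?N = _")
proof -
  let ?q = "CARD('a)"
  obtain r where r: "?q = Suc r" "r > 0"
    using one_less_CARD_field[where ?'a = 'a] by (cases ?q) auto
  have nz: "?q ^ 2 - 1 \<noteq> 0"
    unfolding r using r(2) by (simp add: power2_eq_square)
  have "?N * (?q ^ 2 - 1) = (?q ^ 2 + ?q + 1) * (?q ^ 4 - 1)"
    using card_lines_within[of "UNIV :: ('a ^ 4) set" "?q ^ 2 + ?q + 1"]
      card_lines_through_point[where ?'a = 'a] by simp
  also have "\<dots> = ((?q ^ 2 + 1) * (?q ^ 2 + ?q + 1)) * (?q ^ 2 - 1)"
    unfolding r by (simp add: algebra_simps power2_eq_square power4_eq_xxxx)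
  finally show ?thesis
    using nz by (simp only: mult_cancel_right simp_thms)
qed

section \<open>The twisted cubic and its planes\<close>

lemma vector_4 [simp]:
  "(vector [x, y, z, w] :: 'a::zero ^ 4) $ 1 = x"
  "(vector [x, y, z, w] :: 'a::zero ^ 4) $ 2 = y"
  "(vector [x, y, z, w] :: 'a::zero ^ 4) $ 3 = z"
  "(vector [x, y, z, w] :: 'a::zero ^ 4) $ 4 = w"
  unfolding vector_def by simp_all

definition dot :: "'a::field ^ 4 \<Rightarrow> 'a ^ 4 \<Rightarrow> 'a" where
  "dot c x = c $ 1 * x $ 1 + c $ 2 * x $ 2 + c $ 3 * x $ 3 + c $ 4 * x $ 4"

lemma mem_plane: "x \<in> plane c \<longleftrightarrow> dot c x = 0"
  by (simp add: plane_def dot_def sum_4)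

lemma vec4_eq_iff: "x = y \<longleftrightarrow> x $ 1 = y $ 1 \<and> x $ 2 = y $ 2 \<and> x $ 3 = y $ 3 \<and> x $ 4 = y $ 4"
  for x y :: "'a ^ 4"
  by (simp add: vec_eq_iff forall_4)

text \<open>
  The parameter of a point of the cubic is an option, with \<open>None\<close> for \<open>\<infinity>\<close>; \<open>(hom_u k, hom_v k)\<close>
  are homogeneous coordinates of the parameter \<open>k\<close>, so that the point at infinity needs no
  separate case.
\<close>

fun hom_u :: "'a::field option \<Rightarrow> 'a" where
  "hom_u None = 1" | "hom_u (Some t) = t"

fun hom_v :: "'a::field option \<Rightarrow> 'a" where
  "hom_v None = 0" | "hom_v (Some t) = 1"

text \<open>The determinant of the homogeneous coordinates of two parameters, that is, the value at
  \<open>j\<close> of the linear form with root \<open>k\<close>.\<close>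

definition bracket :: "'a::field option \<Rightarrow> 'a option \<Rightarrow> 'a" where
  "bracket j k = hom_u j * hom_v k - hom_v j * hom_u k"

lemma bracket_eq_0_iff [simp]: "bracket j k = 0 \<longleftrightarrow> j = k"
  by (cases j; cases k) (auto simp: bracket_def)

lemma bracket_self [simp]: "bracket k k = 0"
  by simp

definition cubic_pt :: "'a::field option \<Rightarrow> 'a ^ 4" where
  "cubic_pt k = vector [hom_u k ^ 3, hom_u k ^ 2 * hom_v k, hom_u k * hom_v k ^ 2, hom_v k ^ 3]"

definition osc_form :: "'a::field option \<Rightarrow> 'a ^ 4" where
  "osc_form k = vector [hom_v k ^ 3, - 3 * hom_u k * hom_v k ^ 2, 3 * hom_u k ^ 2 * hom_v k,
      - (hom_u k ^ 3)]"

text \<open>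
  With \<open>L\<^sub>k(u, v) = u * hom_v k - v * hom_u k\<close>, the vector \<open>double_form a b\<close> lists the
  coefficients of the binary cubic form \<open>L\<^sub>a\<^sup>2 L\<^sub>b\<close>, just as \<open>osc_form k\<close> lists those of \<open>L\<^sub>k\<^sup>3\<close>.
\<close>

definition double_form :: "'a::field option \<Rightarrow> 'a option \<Rightarrow> 'a ^ 4" where
  "double_form a b = vector [hom_v a ^ 2 * hom_v b,
      - (hom_v a ^ 2 * hom_u b + 2 * hom_u a * hom_v a * hom_v b),
     hom_u a ^ 2 * hom_v b + 2 * hom_u a * hom_v a * hom_u b, - (hom_u a ^ 2 * hom_u b)]"

text \<open>
  Pairing a cubic form with \<open>quad_polar e m n x y\<close> gives its polar form (scaled by 3) at \<open>(x, y)\<close>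
  and the two roots of the quadratic form \<open>e u\<^sup>2 - m u v + n v\<^sup>2\<close>. Hence these vectors lie on the
  axis belonging to that pair of roots, be they rational or conjugate.
\<close>

definition quad_polar :: "'a::field \<Rightarrow> 'a \<Rightarrow> 'a \<Rightarrow> 'a \<Rightarrow> 'a \<Rightarrow> 'a ^ 4" where
  "quad_polar e m n x y = vector [3 * n * x, m * x + n * y, e * x + m * y, 3 * e * y]"

text \<open>The three coefficients are those of the quadratic form with roots \<open>j\<close> and
  \<open>k\<close>, so the vector lies on the real axis of these two parameters; \<open>i\<close>
  selects the point on it.\<close>

definition root_polar :: "'a::field option \<Rightarrow> 'a option \<Rightarrow> 'a option \<Rightarrow> 'a ^ 4" where
  "root_polar j k i =
     quad_polar (hom_v j * hom_v k) (hom_u j * hom_v k + hom_v j * hom_u k) (hom_u j * hom_u k)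
       (hom_u i) (hom_v i)"

text \<open>Pairing with a point of the cubic evaluates the binary cubic form at the parameter of
  the point.\<close>

lemma dot_osc_form_cubic_pt: "dot (osc_form k) (cubic_pt j) = bracket j k ^ 3"
  by (simp add: dot_def osc_form_def cubic_pt_def bracket_def algebra_simps power2_eq_square
      power3_eq_cube)

lemma dot_double_form_cubic_pt: "dot (double_form a b) (cubic_pt j) = bracket j a ^ 2 * bracket j b"
  by (simp add: dot_def double_form_def cubic_pt_def bracket_def algebra_simps power2_eq_square
      power3_eq_cube)

text \<open>The polar form of a cube is the product of the three values of its linear factor. The
  factor 3 is what makes characteristic 3 behave differently.\<close>

lemma dot_osc_form_root_polar:
  "dot (osc_form h) (root_polar j k i) = 3 * bracket j h * bracket k h * bracket i h"
  by (simp add: dot_def osc_form_def root_polar_def quad_polar_def bracket_def algebra_simps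
      power2_eq_square power3_eq_cube)

lemma dot_double_form_root_polar:
  "dot (double_form a b) (root_polar j k i) =
    bracket j a * bracket k a * bracket i b + bracket j a * bracket k b * bracket i a +
    bracket j b * bracket k a * bracket i a"
  by (simp add: dot_def double_form_def root_polar_def quad_polar_def bracket_def algebra_simps
      power2_eq_square power3_eq_cube)

lemma cubic_pt_nonzero: "cubic_pt k \<noteq> 0"
  by (cases k) (auto simp: cubic_pt_def vec4_eq_iff)

lemma osc_form_nonzero: "osc_form k \<noteq> 0"
  by (cases k) (auto simp: osc_form_def vec4_eq_iff)

lemma cubic_pt_mem_osc_form [simp]: "cubic_pt j \<in> plane (osc_form k) \<longleftrightarrow> j = k"
  by (simp add: mem_plane dot_osc_form_cubic_pt)

lemma cubic_pt_mem_double_form [simp]: "cubic_pt j \<in> plane (double_form a b) \<longleftrightarrow> j = a \<or> j = b"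
  by (simp add: mem_plane dot_double_form_cubic_pt)

lemma exists_not_mem:
  fixes a b :: "'a::{field, finite} option"
  assumes "CARD('a) \<ge> 2"
  shows "\<exists>k. k \<noteq> a \<and> k \<noteq> b"
proof -
  have "card {a, b} < CARD('a option)"
    using assms by (simp add: card_insert_if)
  then have "{a, b} \<noteq> UNIV"
    by (metis less_irrefl)
  then show ?thesis by auto
qed

lemma double_form_nonzero: "double_form a b \<noteq> (0 :: 'a::{field, finite} ^ 4)"
proof
  assume 0: "double_form a b = 0"
  obtain k where "k \<noteq> a" "k \<noteq> b"
    using exists_not_mem[of a b] one_less_CARD_field[where ?'a = 'a] by auto
  then show False
    using cubic_pt_mem_double_form[of k a b] by (simp add: 0 mem_plane dot_def)
qed

text \<open>The osculating plane at \<open>k\<close> separates the two points.\<close>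

lemma cubic_pt_not_in_span: "j \<noteq> k \<Longrightarrow> cubic_pt j \<notin> vec.span {cubic_pt k}"
  using vec.span_minimal[OF _ subspace_plane[of "osc_form k"], of "{cubic_pt k}"] by auto

lemma UNIV_option_param: "range f = insert (f None) (range (\<lambda>t. f (Some t)))"
  by (auto simp: UNIV_option_conv image_image)

lemma twisted_cubic_eq: "twisted_cubic = range (\<lambda>k. proj_point (cubic_pt k))"
  by (simp add: twisted_cubic_def UNIV_option_param cubic_pt_def cubic_vec_def)

lemma Gamma_planes_eq: "Gamma_planes = range (\<lambda>k. plane (osc_form k))"
proof -
  \<comment> \<open>\<open>osc_form None\<close> is the negative of the vector used in
    \<open>Gamma_planes\<close>, so only the planes agree.\<close>
  have "plane (osc_form None) = plane (vector [0, 0, 0, 1] :: 'a ^ 4)"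
    by (auto simp: mem_plane dot_def osc_form_def)
  then show ?thesis
    by (simp add: Gamma_planes_def UNIV_option_param osc_form_def osc_vec_def)
qed

lemma proj_point_subset_iff: "vec.subspace S \<Longrightarrow> proj_point x \<subseteq> S \<longleftrightarrow> x \<in> S"
  using vec.span_minimal[of "{x}" S] vec.span_base[of x "{x}"] by (auto simp: proj_point_def)

lemma inj_cubic_points: "inj (\<lambda>k. proj_point (cubic_pt k))"
proof (rule injI)
  fix j k :: "'a option"
  assume "proj_point (cubic_pt j) = proj_point (cubic_pt k)"
  then have "cubic_pt j \<in> vec.span {cubic_pt k}"
    unfolding proj_point_def by (metis vec.span_base insertI1)
  then show "j = k"
    using cubic_pt_not_in_span by blast
qed

lemma card_cubic_points:
  "card {P \<in> twisted_cubic. P \<subseteq> plane c} = card {k. cubic_pt k \<in> plane c}"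
proof -
  have "{P \<in> twisted_cubic. P \<subseteq> plane c} = (\<lambda>k. proj_point (cubic_pt k)) `
      {k. cubic_pt k \<in> plane c}"
    using proj_point_subset_iff[OF subspace_plane] by (auto simp: twisted_cubic_eq)
  then show ?thesis
    by (simp add: card_image inj_on_subset[OF inj_cubic_points])
qed

lemma plane_scale: "r \<noteq> 0 \<Longrightarrow> plane (r *s c) = plane c"
proof -
  assume "r \<noteq> 0"
  moreover have "dot (r *s c) x = r * dot c x" for x
    by (simp add: dot_def algebra_simps)
  ultimately show ?thesis
    by (auto simp: mem_plane)
qed

text \<open>
  Expands the binary cubic form with coefficients \<open>c\<close> in the two linear forms \<open>L\<^sub>j\<close>, \<open>L\<^sub>k\<close>.
\<close>

lemma form_decomposition:
  "bracket k j ^ 3 *s c = dot c (cubic_pt k) *s osc_form j - dot c (root_polar k k j) *s double_form j k +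
     dot c (root_polar j j k) *s double_form k j - dot c (cubic_pt j) *s osc_form k"
  unfolding vec4_eq_iff
  by (intro conjI)
    (simp_all add: dot_def osc_form_def cubic_pt_def double_form_def root_polar_def quad_polar_def
      bracket_def
      algebra_simps power2_eq_square power3_eq_cube)

section \<open>Planes meeting the cubic in exactly two points\<close>

lemma normalize_param:
  assumes "(x, y) \<noteq> (0, 0)"
  obtains i r where "r \<noteq> 0" "x = r * hom_u i" "y = r * hom_v i"
proof (cases "y = 0")
  case True
  then show ?thesis using that[of x None] assms by simp
next
  case False
  then show ?thesis using that[of y "Some (x / y)"] by simp
qed

lemma dot_scale_left: "dot (r *s c) x = r * dot c x"
  and dot_add_left: "dot (c + d) x = dot c x + dot d x"
  by (simp_all add: dot_def algebra_simps)

text \<open>If the form of \<open>c\<close> vanishes at \<open>j\<close> and \<open>k\<close> only,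
  the cubes drop out of its decomposition and leave L_j L_k (lam L_j + mu L_k). If
  \<open>lam\<close> and \<open>mu\<close> were both non-zero, the last factor would have a root
  other than \<open>j\<close> and \<open>k\<close>; hence one of them is zero.\<close>

lemma two_C_planes_eq:
  "two_C_planes = (\<lambda>(a, b). plane (double_form a b)) `
     {(a, b :: 'a::{field, finite} option). a \<noteq> b}"
proof (intro equalityI subsetI)
  fix p :: "('a ^ 4) set"
  assume "p \<in> (\<lambda>(a, b). plane (double_form a b)) ` {(a, b). a \<noteq> b}"
  then obtain a b where p: "p = plane (double_form a b)" "a \<noteq> b"
    by auto
  have "{k. k = a \<or> k = b} = {a, b}"
    by auto
  then show "p \<in> two_C_planes"
    using p double_form_nonzero by (auto simp: two_C_planes_def proj_planes_def card_cubic_points)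
next
  fix p :: "('a ^ 4) set"
  assume "p \<in> two_C_planes"
  then obtain c where p: "p = plane c" "c \<noteq> 0" and "card {k. cubic_pt k \<in> plane c} = 2"
    by (auto simp: two_C_planes_def proj_planes_def card_cubic_points)
  then obtain j k where jk: "{i. dot c (cubic_pt i) = 0} = {j, k}" "j \<noteq> k"
    by (auto simp: card_2_iff mem_plane)
  define d where "d = bracket k j ^ 3"
  have d: "d \<noteq> 0"
    using jk(2) by (auto simp: d_def)
  define lam where "lam = - (dot c (root_polar k k j) / d)"
  define mu where "mu = dot c (root_polar j j k) / d"
  have roots: "dot c (cubic_pt i) = 0 \<longleftrightarrow> i = j \<or> i = k" for i
    using jk(1) by auto
  have "d *s c = d *s (lam *s double_form j k + mu *s double_form k j)"
    using form_decomposition[of k j c] roots[of j] roots[of k] d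
    by (simp add: d_def lam_def mu_def vec.scale_right_distrib)
  then have c: "c = lam *s double_form j k + mu *s double_form k j"
    using d by (simp only: vec.scale_cancel_left simp_thms)
  have "lam = 0 \<or> mu = 0"
  proof (rule ccontr)
    assume "\<not> ?thesis"
    then have nz: "lam \<noteq> 0" "mu \<noteq> 0" by auto
    \<comment> \<open>\<open>(x, y)\<close> are homogeneous coordinates of the root of the linear
      factor lam L_j + mu L_k.\<close>
    define x where "x = lam * hom_u j + mu * hom_u k"
    define y where "y = lam * hom_v j + mu * hom_v k"
    have xj: "x * hom_v j - y * hom_u j = mu * bracket k j"
      and xk: "x * hom_v k - y * hom_u k = lam * bracket j k"
      by (simp_all add: x_def y_def bracket_def algebra_simps)
    have "(x, y) \<noteq> (0, 0)"
      using xj nz jk(2) by auto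
    then obtain i r where r: "r \<noteq> 0" "x = r * hom_u i" "y = r * hom_v i"
      by (rule normalize_param)
    have ij: "r * bracket i j = mu * bracket k j" and ik: "r * bracket i k = lam * bracket j k"
      using xj xk by (simp_all add: r bracket_def algebra_simps)
    have "i \<noteq> j" "i \<noteq> k"
      using ij ik nz jk(2) by auto
    have "r ^ 3 * dot c (cubic_pt i) =
        r * bracket i j * (r * bracket i k) * (lam * (r * bracket i j) + mu * (r * bracket i k))"
      by (simp add: c dot_add_left dot_scale_left dot_double_form_cubic_pt algebra_simps
          power2_eq_square power3_eq_cube)
    also have "lam * (r * bracket i j) + mu * (r * bracket i k) = 0"
      unfolding ij ik by (simp add: bracket_def algebra_simps)
    finally have "dot c (cubic_pt i) = 0"
      using r by simp
    then show False
      using roots \<open>i \<noteq> j\<close> \<open>i \<noteq> k\<close> by blast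
  qed
  then have "p = plane (double_form j k) \<or> p = plane (double_form k j)"
    using c p by (auto simp: plane_scale)
  then show "p \<in> (\<lambda>(a, b). plane (double_form a b)) ` {(a, b). a \<noteq> b}"
    using jk(2) by auto
qed

lemma inj_on_double_form:
  "inj_on (\<lambda>(a, b). plane (double_form a b)) {(a, b :: 'a::{field, finite} option). a \<noteq> b}"
proof (rule inj_onI, clarify)
  fix a b c d :: "'a option"
  assume ne: "a \<noteq> b" "c \<noteq> d" and eq: "plane (double_form a b) = plane (double_form c d)"
  have "k = a \<or> k = b \<longleftrightarrow> k = c \<or> k = d" for k
    using eq cubic_pt_mem_double_form by blast
  then consider "c = a \<and> d = b" | "c = b" "d = a"
    using ne by metis
  then show "a = c \<and> b = d"
  proof cases
    case 2
    \<comment> \<open>The points on the cubic determine only the unordered pair. The polar form at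
      \<open>a\<close>, \<open>a\<close>, \<open>b\<close> detects which root is double: it vanishes
      for L_a^2 L_b but not for L_b^2 L_a.\<close>
    have "root_polar a a b \<in> plane (double_form a b)" "root_polar a a b \<notin> plane (double_form b a)"
      using ne by (auto simp: mem_plane dot_double_form_root_polar)
    then show ?thesis
      using eq 2 by simp
  qed simp
qed

lemma card_two_C_planes:
  "card (two_C_planes :: ('a::{field, finite} ^ 4) set set) = (CARD('a) + 1) * CARD('a)"
proof -
  have "{(a, b :: 'a option). a \<noteq> b} = UNIV - range (\<lambda>a. (a, a))"
    by auto
  moreover have "card (range (\<lambda>a :: 'a option. (a, a))) = CARD('a) + 1"
    by (subst card_image) (auto simp: inj_on_def)
  ultimately have "card {(a, b :: 'a option). a \<noteq> b} =
      (CARD('a) + 1) * (CARD('a) + 1) - (CARD('a) + 1)"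
    by (simp add: card_Diff_subset)
  then show ?thesis
    by (simp add: two_C_planes_eq card_image[OF inj_on_double_form])
qed

section \<open>Imaginary chords and imaginary axes\<close>

text \<open>Trace and norm of a conjugate pair: these \<open>(m, n)\<close> parametrise the pairs of
  non-rational roots while staying inside the base field.\<close>

definition irreducible_pairs :: "('a::field \<times> 'a) set" where
  "irreducible_pairs = {(m, n). \<forall>t. t ^ 2 - m * t + n \<noteq> 0}"

text \<open>
  For \<open>s\<close> and its conjugate with sum \<open>m\<close> and product \<open>n\<close>, these are the imaginary chord and the
  imaginary axis in coordinates over the base field, obtained from \<open>s\<^sup>2 = m s - n\<close>.
\<close>

definition conj_chord :: "'a::field \<Rightarrow> 'a \<Rightarrow> ('a ^ 4) set" where
  "conj_chord m n = {x. x $ 1 = (m ^ 2 - n) * x $ 3 - m * n * x $ 4 \<and>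
     x $ 2 = m * x $ 3 - n * x $ 4}"

definition conj_axis :: "'a::field \<Rightarrow> 'a \<Rightarrow> ('a ^ 4) set" where
  "conj_axis m n = {x. x $ 1 = 3 * n * x $ 3 - m * n * x $ 4 \<and>
     3 * x $ 2 = 3 * m * x $ 3 - (m ^ 2 - n) * x $ 4}"

text \<open>The homogenised quadratic at a parameter, so that infinity is included. It is the norm
  of the linear form with root \<open>k\<close>, evaluated at s.\<close>

definition quad_form :: "'a::field \<Rightarrow> 'a \<Rightarrow> 'a option \<Rightarrow> 'a" where
  "quad_form m n k = hom_u k ^ 2 - m * hom_u k * hom_v k + n * hom_v k ^ 2"

lemma quad_form_nonzero: "(m, n) \<in> irreducible_pairs \<Longrightarrow> quad_form m n k \<noteq> 0"
  by (cases k) (auto simp: quad_form_def irreducible_pairs_def)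

text \<open>Frobenius swaps \<open>s\<close> and its conjugate, so it fixes their sum and product,
  which therefore lie in the base field. A root there of the resulting quadratic would be one of the
  two conjugates.\<close>

lemma quad_ext_trace_norm:
  fixes s :: "'a::{field, finite} alg_closure"
  assumes "s \<in> quad_ext_nonbase"
  obtains m n where "(m, n) \<in> irreducible_pairs" "s + s ^ CARD('a) = to_ac m"
    "s * s ^ CARD('a) = to_ac n"
proof -
  define s' where "s' = s ^ CARD('a)"
  have s: "s ^ (CARD('a) ^ 2) = s" "s \<notin> range to_ac"
    using assms by (auto simp: quad_ext_nonbase_def)
  have s': "s' ^ CARD('a) = s"
    using s(1) by (simp add: s'_def power2_eq_square power_mult)
  have "s' \<noteq> s"
    using s(2) by (auto simp: range_to_ac_eq s'_def)
  then have "s' \<notin> range to_ac"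
    by (simp add: range_to_ac_eq s')
  have "s + s' \<in> range to_ac"
    unfolding range_to_ac_eq by (simp add: power_CARD_add s' flip: s'_def)
  moreover have "s * s' \<in> range to_ac"
    unfolding range_to_ac_eq by (simp add: power_mult_distrib s' flip: s'_def)
  ultimately obtain m n where mn: "s + s' = to_ac m" "s * s' = to_ac n"
    by blast
  have "t ^ 2 - m * t + n \<noteq> 0" for t
  proof
    assume "t ^ 2 - m * t + n = 0"
    then have "to_ac (t ^ 2 - m * t + n) = 0"
      by simp
    then have "to_ac t ^ 2 - (s + s') * to_ac t + s * s' = 0"
      by (simp add: mn)
    then have "(to_ac t - s) * (to_ac t - s') = 0"
      by (simp add: algebra_simps power2_eq_square)
    then show False
      using s(2) \<open>s' \<notin> range to_ac\<close> by auto
  qed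
  then show ?thesis
    using that[of m n] mn by (simp add: irreducible_pairs_def s'_def)
qed

text \<open>A root \<open>s\<close> exists in the algebraic closure. Frobenius sends it to a root
  again, and to a different one because \<open>s\<close> is not in the base field; sum and product
  then follow by Vieta. Applying Frobenius to the sum shows that its square fixes
  \<open>s\<close>.\<close>

lemma quad_ext_root:
  fixes m n :: "'a::{field, finite}"
  assumes "(m, n) \<in> irreducible_pairs"
  obtains s where "s \<in> quad_ext_nonbase" "s + s ^ CARD('a) = to_ac m" "s * s ^ CARD('a) = to_ac n"
proof -
  let ?q = "CARD('a)"
  obtain s where "poly [:to_ac n, - to_ac m, 1:] s = 0"
    using alg_closed_imp_poly_has_root[of "[:to_ac n, - to_ac m, 1:]"] by auto
  then have s: "s ^ 2 + to_ac n = to_ac m * s"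
    by (simp add: algebra_simps power2_eq_square)
  have nb: "s \<notin> range to_ac"
  proof
    assume "s \<in> range to_ac"
    then obtain t where "s = to_ac t" by auto
    with s have "to_ac (t ^ 2 + n) = to_ac (m * t)"
      by simp
    then have "t ^ 2 - m * t + n = 0"
      by (simp only: to_ac_eq_iff) (simp add: algebra_simps)
    then show False
      using assms by (auto simp: irreducible_pairs_def)
  qed
  define s' where "s' = s ^ ?q"
  have fix_base: "to_ac x ^ ?q = to_ac x" for x :: 'a
    by (simp add: power_CARD_eq_same flip: to_ac_power)
  have "s' \<noteq> s"
    using nb by (auto simp: range_to_ac_eq s'_def)
  have "(s ^ 2 + to_ac n) ^ ?q = (to_ac m * s) ^ ?q"
    by (simp only: s)
  then have "s' ^ 2 + to_ac n = to_ac m * s'"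
    by (simp add: power_CARD_add fix_base power_mult_distrib s'_def flip: power_mult)
      (simp add: mult.commute)
  with s have "(s' ^ 2 + to_ac n) - (s ^ 2 + to_ac n) = to_ac m * s' - to_ac m * s"
    by simp
  then have "(s' - s) * (s + s' - to_ac m) = 0"
    by (simp add: algebra_simps power2_eq_square)
  then have sum: "s + s' = to_ac m"
    using \<open>s' \<noteq> s\<close> by simp
  then have prod: "s * s' = to_ac n"
    using s by (simp add: power2_eq_square algebra_simps flip: sum)
  have "s' + s' ^ ?q = to_ac m"
    using sum fix_base[of m] by (metis power_CARD_add s'_def)
  then have "s' ^ ?q = s"
    using sum by (metis add.commute add_left_cancel)
  then have "s ^ (?q ^ 2) = s"
    by (simp add: s'_def power2_eq_square power_mult)
  then show ?thesis
    using that[of s] nb sum prod by (simp add: quad_ext_nonbase_def s'_def)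
qed

lemma quad_ext_conj_neq: "s \<in> quad_ext_nonbase \<Longrightarrow> s ^ CARD('a) \<noteq> s"
  for s :: "'a::{field, finite} alg_closure"
  by (auto simp: quad_ext_nonbase_def range_to_ac_eq)

lemma lift_vec_nth [simp]: "lift_vec x $ i = to_ac (x $ i)"
  by (simp add: lift_vec_def)

text \<open>The last two coordinates determine the coefficients of the two conjugate points. The
  first two coordinates then follow from s^2 = m s - n and s^3 = (m^2 - n) s - m n, satisfied by
  both conjugates.\<close>

lemma imaginary_chord_eq:
  fixes s :: "'a::{field, finite} alg_closure"
  assumes "s \<in> quad_ext_nonbase" "s + s ^ CARD('a) = to_ac m" "s * s ^ CARD('a) = to_ac n"
  shows "{x. lift_vec x \<in> vec.span {cubic_vec s, cubic_vec (s ^ CARD('a))}} = conj_chord m n"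
proof -
  define s' where "s' = s ^ CARD('a)"
  have ne: "s' \<noteq> s"
    using quad_ext_conj_neq[OF assms(1)] by (simp add: s'_def)
  have mn: "to_ac m = s + s'" "to_ac n = s * s'"
    using assms by (simp_all add: s'_def)
  have conj_chord: "x \<in> conj_chord m n \<longleftrightarrow>
      to_ac (x $ 1) = ((s + s') ^ 2 - s * s') * to_ac (x $ 3) -
        (s + s') * (s * s') * to_ac (x $ 4) \<and>
      to_ac (x $ 2) = (s + s') * to_ac (x $ 3) - s * s' * to_ac (x $ 4)" for x
    unfolding conj_chord_def mem_Collect_eq mn[symmetric]
    by (simp only: to_ac_eq_iff flip: to_ac_mult to_ac_diff to_ac_power)
  have span: "y \<in> vec.span {cubic_vec s, cubic_vec s'} \<longleftrightarrow>
      (\<exists>a b. y = a *s cubic_vec s + b *s cubic_vec s')" for y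
    by (auto simp: vec.span_insert vec.span_singleton algebra_simps)
  have "lift_vec x \<in> vec.span {cubic_vec s, cubic_vec s'} \<longleftrightarrow> x \<in> conj_chord m n" for x
  proof
    assume "lift_vec x \<in> vec.span {cubic_vec s, cubic_vec s'}"
    then obtain a b where "lift_vec x = a *s cubic_vec s + b *s cubic_vec s'"
      using span by blast
    then have "to_ac (x $ 1) = a * s ^ 3 + b * s' ^ 3" "to_ac (x $ 2) = a * s ^ 2 + b * s' ^ 2"
      "to_ac (x $ 3) = a * s + b * s'" "to_ac (x $ 4) = a + b"
      by (simp_all add: vec4_eq_iff cubic_vec_def)
    then show "x \<in> conj_chord m n"
      unfolding conj_chord by (simp add: algebra_simps power2_eq_square power3_eq_cube)
  next
    assume x: "x \<in> conj_chord m n"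
    \<comment> \<open>\<open>a\<close> and \<open>b\<close> solve the linear system given by the
      last two coordinates, whose determinant is \<open>s' - s\<close>.\<close>
    define b where "b = (to_ac (x $ 3) - s * to_ac (x $ 4)) / (s' - s)"
    define a where "a = to_ac (x $ 4) - b"
    have 4: "to_ac (x $ 4) = a + b"
      by (simp add: a_def)
    have "b * (s' - s) = to_ac (x $ 3) - s * to_ac (x $ 4)"
      using ne by (simp add: b_def)
    then have 3: "to_ac (x $ 3) = a * s + b * s'"
      by (simp add: 4 algebra_simps)
    have "lift_vec x = a *s cubic_vec s + b *s cubic_vec s'"
      using x unfolding conj_chord
      by (simp add: vec4_eq_iff cubic_vec_def 3 4 algebra_simps power2_eq_square power3_eq_cube)
    then show "lift_vec x \<in> vec.span {cubic_vec s, cubic_vec s'}"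
      using span by blast
  qed
  then show ?thesis
    by (auto simp: s'_def)
qed

text \<open>Reducing the powers of the root by the quadratic turns the two plane equations into
  \<open>e + s * d = 0\<close> and \<open>e + s' * d = 0\<close> with the same \<open>e\<close> and
  \<open>d\<close>. As the conjugates differ, both coefficients vanish, and these are the equations
  of \<open>conj_axis\<close>.\<close>

lemma imaginary_axis_eq:
  fixes s :: "'a::{field, finite} alg_closure"
  assumes "s \<in> quad_ext_nonbase" "s + s ^ CARD('a) = to_ac m" "s * s ^ CARD('a) = to_ac n"
  shows "{x. lift_vec x \<in> plane (osc_vec s) \<inter> plane (osc_vec (s ^ CARD('a)))} = conj_axis m n"
proof -
  define s' where "s' = s ^ CARD('a)"
  have ne: "s' \<noteq> s"
    using quad_ext_conj_neq[OF assms(1)] by (simp add: s'_def)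
  have mn: "to_ac m = s + s'" "to_ac n = s * s'"
    using assms by (simp_all add: s'_def)
  have "lift_vec x \<in> plane (osc_vec s) \<inter> plane (osc_vec s') \<longleftrightarrow> x \<in> conj_axis m n" for x
  proof -
    define y where "y i = to_ac (x $ i)" for i :: 4
    define e where "e = y 1 - 3 * (s * s') * y 3 + (s + s') * (s * s') * y 4"
    define d where "d = 3 * (s + s') * y 3 - ((s + s') ^ 2 - s * s') * y 4 - 3 * y 2"
    have "x \<in> conj_axis m n \<longleftrightarrow> e = 0 \<and> d = 0"
    proof -
      have "x $ 1 = 3 * n * x $ 3 - m * n * x $ 4 \<longleftrightarrow>
          to_ac (x $ 1) = to_ac (3 * n * x $ 3 - m * n * x $ 4)"
        by (simp only: to_ac_eq_iff)
      also have "\<dots> \<longleftrightarrow> e = 0"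
        by (simp add: mn e_def y_def algebra_simps)
      finally have 1: "x $ 1 = 3 * n * x $ 3 - m * n * x $ 4 \<longleftrightarrow> e = 0" .
      have "3 * x $ 2 = 3 * m * x $ 3 - (m ^ 2 - n) * x $ 4 \<longleftrightarrow>
          to_ac (3 * x $ 2) = to_ac (3 * m * x $ 3 - (m ^ 2 - n) * x $ 4)"
        by (simp only: to_ac_eq_iff)
      also have "\<dots> \<longleftrightarrow> d = 0"
        by (simp only: mn d_def y_def to_ac_mult to_ac_diff to_ac_numeral to_ac_power
            right_minus_eq eq_commute[of "3 * _"])
      finally show ?thesis
        using 1 by (simp add: conj_axis_def)
    qed
    moreover have "lift_vec x \<in> plane (osc_vec s) \<longleftrightarrow> e + s * d = 0"
      by (simp add: mem_plane dot_def osc_vec_def e_def d_def y_def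
          algebra_simps power2_eq_square power3_eq_cube)
    moreover have "lift_vec x \<in> plane (osc_vec s') \<longleftrightarrow> e + s' * d = 0"
      by (simp add: mem_plane dot_def osc_vec_def e_def d_def y_def
          algebra_simps power2_eq_square power3_eq_cube)
    moreover have "e + s * d = 0 \<and> e + s' * d = 0 \<longleftrightarrow> e = 0 \<and> d = 0"
    proof
      assume h: "e + s * d = 0 \<and> e + s' * d = 0"
      then have "(e + s' * d) - (e + s * d) = 0"
        by simp
      then have "(s' - s) * d = 0"
        by (simp add: left_diff_distrib)
      with h ne show "e = 0 \<and> d = 0"
        by simp
    qed simp
    ultimately show ?thesis
      by blast
  qed
  then show ?thesis
    by (auto simp: s'_def)
qed

lemma imaginary_chords_eq: "imaginary_chords = (\<lambda>(m, n). conj_chord m n) ` irreducible_pairs"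
  unfolding imaginary_chords_def
proof (intro equalityI subsetI)
  fix l :: "('a ^ 4) set"
  assume "l \<in> {{x. lift_vec x \<in> vec.span {cubic_vec s, cubic_vec (s ^ CARD('a))}} |s.
      s \<in> quad_ext_nonbase}"
  then obtain s where s: "s \<in> quad_ext_nonbase"
    and l: "l = {x. lift_vec x \<in> vec.span {cubic_vec s, cubic_vec (s ^ CARD('a))}}"
    by blast
  obtain m n where mn: "(m, n) \<in> irreducible_pairs" "s + s ^ CARD('a) = to_ac m"
      "s * s ^ CARD('a) = to_ac n"
    using quad_ext_trace_norm[OF s] .
  then have "l = conj_chord m n"
    using imaginary_chord_eq[OF s] l by simp
  then show "l \<in> (\<lambda>(m, n). conj_chord m n) ` irreducible_pairs"
    using mn(1) by auto
next
  fix l :: "('a ^ 4) set"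
  assume "l \<in> (\<lambda>(m, n). conj_chord m n) ` irreducible_pairs"
  then obtain m n where l: "l = conj_chord m n" "(m, n) \<in> irreducible_pairs" by auto
  obtain s where "s \<in> quad_ext_nonbase" "s + s ^ CARD('a) = to_ac m" "s * s ^ CARD('a) = to_ac n"
    using quad_ext_root[OF l(2)] .
  then show "l \<in> {{x. lift_vec x \<in> vec.span {cubic_vec s, cubic_vec (s ^ CARD('a))}} |s.
      s \<in> quad_ext_nonbase}"
    using imaginary_chord_eq[of s m n] l(1) by blast
qed

lemma imaginary_axes_eq: "imaginary_axes = (\<lambda>(m, n). conj_axis m n) ` irreducible_pairs"
  unfolding imaginary_axes_def
proof (intro equalityI subsetI)
  fix l :: "('a ^ 4) set"
  assume "l \<in> {{x. lift_vec x \<in> plane (osc_vec s) \<inter> plane (osc_vec (s ^ CARD('a)))} |s.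
      s \<in> quad_ext_nonbase}"
  then obtain s where s: "s \<in> quad_ext_nonbase"
    and l: "l = {x. lift_vec x \<in> plane (osc_vec s) \<inter> plane (osc_vec (s ^ CARD('a)))}"
    by blast
  obtain m n where mn: "(m, n) \<in> irreducible_pairs" "s + s ^ CARD('a) = to_ac m"
      "s * s ^ CARD('a) = to_ac n"
    using quad_ext_trace_norm[OF s] .
  then have "l = conj_axis m n"
    using imaginary_axis_eq[OF s] l by simp
  then show "l \<in> (\<lambda>(m, n). conj_axis m n) ` irreducible_pairs"
    using mn(1) by auto
next
  fix l :: "('a ^ 4) set"
  assume "l \<in> (\<lambda>(m, n). conj_axis m n) ` irreducible_pairs"
  then obtain m n where l: "l = conj_axis m n" "(m, n) \<in> irreducible_pairs" by auto
  obtain s where "s \<in> quad_ext_nonbase" "s + s ^ CARD('a) = to_ac m" "s * s ^ CARD('a) = to_ac n"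
    using quad_ext_root[OF l(2)] .
  then show "l \<in> {{x. lift_vec x \<in> plane (osc_vec s) \<inter> plane (osc_vec (s ^ CARD('a)))} |s.
      s \<in> quad_ext_nonbase}"
    using imaginary_axis_eq[of s m n] l(1) by blast
qed

section \<open>Incidences of imaginary chords and axes\<close>

lemma graph_in_proj_lines:
  fixes a b c d :: "'a::{field, finite}"
  shows "{x. x $ 1 = a * x $ 3 + b * x $ 4 \<and> x $ 2 = c * x $ 3 + d * x $ 4} \<in> proj_lines"
    (is "?l \<in> _")
proof -
  have "bij_betw (\<lambda>(y, z). vector [a * y + b * z, c * y + d * z, y, z]) UNIV ?l"
    by (rule bij_betwI[where g = "\<lambda>x :: 'a ^ 4. (x $ 3, x $ 4)"]) (auto simp: vec4_eq_iff)
  from bij_betw_same_card[OF this] have "card ?l = CARD('a) ^ 2"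
    by (simp add: power2_eq_square)
  moreover have "vec.subspace ?l"
    by (auto simp: vec.subspace_def algebra_simps)
  ultimately show ?thesis
    by (simp add: proj_lines_iff)
qed

lemma conj_chord_in_proj_lines: "conj_chord m n \<in> proj_lines" for m n :: "'a::{field, finite}"
  using graph_in_proj_lines[of "m ^ 2 - n" "- (m * n)" m "- n"] by (simp add: conj_chord_def)

lemma conj_axis_in_proj_lines:
  fixes m n :: "'a::{field, finite}"
  assumes "(3 :: 'a) \<noteq> 0"
  shows "conj_axis m n \<in> proj_lines"
proof -
  have "3 * y = 3 * m * u - (m ^ 2 - n) * v \<longleftrightarrow> y = m * u + (- ((m ^ 2 - n) / 3)) * v" for y u v
    using assms by (simp add: field_simps)
  then show ?thesis
    using graph_in_proj_lines[of "3 * n" "- (m * n)" m "- ((m ^ 2 - n) / 3)"]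
      by (simp add: conj_axis_def)
qed

lemma cubic_pt_not_in_conj_chord: "(m, n) \<in> irreducible_pairs \<Longrightarrow> cubic_pt k \<notin> conj_chord m n"
  by (cases k) (auto simp: conj_chord_def cubic_pt_def irreducible_pairs_def algebra_simps)

text \<open>The left-hand sides are the two coefficients of the cubic form reduced modulo s^2 = m s
  - n. They arise as values at the points of the chord with last coordinates (1, 0) and (0,
  1).\<close>

lemma conj_chord_plane:
  fixes c :: "'a::field ^ 4"
  assumes "conj_chord m n \<subseteq> plane c"
  shows "c $ 1 * (m ^ 2 - n) + c $ 2 * m + c $ 3 = 0" "c $ 4 - c $ 1 * (m * n) - c $ 2 * n = 0"
proof -
  have "vector [m ^ 2 - n, m, 1, 0] \<in> conj_chord m n"
      "vector [- (m * n), - n, 0, 1] \<in> conj_chord m n"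
    by (simp_all add: conj_chord_def)
  then have "vector [m ^ 2 - n, m, 1, 0] \<in> plane c" "vector [- (m * n), - n, 0, 1] \<in> plane c"
    using assms by blast+
  then show "c $ 1 * (m ^ 2 - n) + c $ 2 * m + c $ 3 = 0" "c $ 4 - c $ 1 * (m * n) - c $ 2 * n = 0"
    by (simp_all add: mem_plane dot_def algebra_simps)
qed

text \<open>
  The norm of the value at \<open>s\<close> of the cubic form with coefficients \<open>c\<close>, where \<open>s\<^sup>2 = m s - n\<close>:
  that value is \<open>e s + d\<close>. It is multiplicative in the form, and it vanishes if the plane contains
  the chord.
\<close>

definition conj_norm :: "'a::field ^ 4 \<Rightarrow> 'a \<Rightarrow> 'a \<Rightarrow> 'a" where
  "conj_norm c m n = (let e = c $ 1 * (m ^ 2 - n) + c $ 2 * m + c $ 3;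
     d = c $ 4 - c $ 1 * (m * n) - c $ 2 * n in e ^ 2 * n + e * d * m + d ^ 2)"

lemma conj_norm_osc_form: "conj_norm (osc_form k) m n = quad_form m n k ^ 3"
  by (simp add: conj_norm_def Let_def osc_form_def quad_form_def algebra_simps power2_eq_square
      power3_eq_cube)

lemma conj_norm_double_form:
  "conj_norm (double_form a b) m n = quad_form m n a ^ 2 * quad_form m n b"
  by (simp add: conj_norm_def Let_def double_form_def quad_form_def algebra_simps power2_eq_square)

text \<open>Containment would make \<open>conj_norm\<close> zero, but here it is the cube of a value
  of \<open>quad_form\<close>, which has no root.\<close>

lemma conj_chord_not_in_osc_form:
  "(m, n) \<in> irreducible_pairs \<Longrightarrow> \<not> conj_chord m n \<subseteq> plane (osc_form k)"
  using conj_chord_plane[of m n "osc_form k"] conj_norm_osc_form[of k m n]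
      quad_form_nonzero[of m n k]
  by (auto simp: conj_norm_def)

lemma conj_chord_not_in_double_form:
  "(m, n) \<in> irreducible_pairs \<Longrightarrow> \<not> conj_chord m n \<subseteq> plane (double_form a b)"
  using conj_chord_plane[of m n "double_form a b"] conj_norm_double_form[of a b m n]
      quad_form_nonzero[of m n a] quad_form_nonzero[of m n b]
  by (auto simp: conj_norm_def)

lemma cubic_pt_not_in_conj_axis:
  assumes "(m, n) \<in> irreducible_pairs"
  shows "cubic_pt k \<notin> conj_axis m n"
proof
  assume "cubic_pt k \<in> conj_axis m n"
  then have h: "hom_u k ^ 3 = 3 * n * (hom_u k * hom_v k ^ 2) - m * n * hom_v k ^ 3"
    "3 * (hom_u k ^ 2 * hom_v k) = 3 * m * (hom_u k * hom_v k ^ 2) - (m ^ 2 - n) * hom_v k ^ 3"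
    by (simp_all add: conj_axis_def cubic_pt_def)
  \<comment> \<open>For a point of the cubic, the two equations of the axis say that both
    coefficients of the reduced form L_k^3 vanish.\<close>
  then have "conj_norm (osc_form k) m n = 0"
    by (simp add: conj_norm_def Let_def osc_form_def algebra_simps)
  then show False
    using quad_form_nonzero[OF assms, of k] by (simp add: conj_norm_osc_form)
qed

lemma quad_polar_in_conj_axis: "quad_polar 1 m n x y \<in> conj_axis m n"
  by (simp add: conj_axis_def quad_polar_def algebra_simps power2_eq_square)

lemma dot_osc_form_quad_polar:
  "dot (osc_form k) (quad_polar 1 m n (hom_u i) (hom_v i)) = 3 * quad_form m n k * bracket i k"
  by (simp add: dot_def osc_form_def quad_polar_def quad_form_def bracket_def algebra_simps
      power2_eq_square power3_eq_cube)

text \<open>Since L_a vanishes at \<open>a\<close>, only one term of the polar form survives: the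
  norm of L_a times the value of L_b at \<open>a\<close>. This supplies a point of the axis outside
  the plane.\<close>

lemma dot_double_form_quad_polar:
  "dot (double_form a b) (quad_polar 1 m n (hom_u a) (hom_v a)) = quad_form m n a * bracket a b"
  by (simp add: dot_def double_form_def quad_polar_def quad_form_def bracket_def algebra_simps
      power2_eq_square power3_eq_cube)

lemma conj_axis_not_in_osc_form:
  fixes m n :: "'a::{field, finite}"
  assumes "(m, n) \<in> irreducible_pairs" "(3 :: 'a) \<noteq> 0"
  shows "\<not> conj_axis m n \<subseteq> plane (osc_form k)"
proof
  assume "conj_axis m n \<subseteq> plane (osc_form k)"
  moreover obtain i where "i \<noteq> k"
    using exists_not_mem[of k k] one_less_CARD_field[where ?'a = 'a] by auto
  ultimately show False
    using quad_polar_in_conj_axis[of m n "hom_u i" "hom_v i"]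
      dot_osc_form_quad_polar[of k m n i] quad_form_nonzero[OF assms(1), of k] assms(2)
    by (auto simp: subset_iff mem_plane)
qed

lemma conj_axis_not_in_double_form:
  assumes "(m, n) \<in> irreducible_pairs" "a \<noteq> b"
  shows "\<not> conj_axis m n \<subseteq> plane (double_form a b)"
  using quad_polar_in_conj_axis[of m n "hom_u a" "hom_v a"]
    dot_double_form_quad_polar[of a b m n] quad_form_nonzero[OF assms(1), of a] assms(2)
  by (auto simp: subset_iff mem_plane)

text \<open>Zero discriminant means a double root in the base field: \<open>m / 2\<close> if 2 is
  invertible, and otherwise a square root of \<open>- n\<close>, which exists because squaring is
  injective on a finite field of characteristic 2.\<close>

lemma irreducible_pairs_discriminant:
  fixes m n :: "'a::{field, finite}"
  assumes "(m, n) \<in> irreducible_pairs"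
  shows "m ^ 2 \<noteq> 4 * n"
proof
  assume eq: "m ^ 2 = 4 * n"
  show False
  proof (cases "(2 :: 'a) = 0")
    case True
    then have "(4 :: 'a) = 0"
      by (metis mult_2 numeral_Bit0 add_0)
    then have "m = 0"
      using eq by simp
    have "inj (\<lambda>t :: 'a. t ^ 2)"
    proof (rule injI)
      fix s t :: 'a
      assume "s ^ 2 = t ^ 2"
      then have "(s - t) * (s - t) = 2 * (t * (t - s))"
        by (simp add: algebra_simps power2_eq_square)
      then show "s = t"
        using True by simp
    qed
    then have "surj (\<lambda>t :: 'a. t ^ 2)"
      by (simp add: finite_UNIV_inj_surj)
    then obtain t where "t ^ 2 = - n"
      by (metis surjD)
    then show False
      using assms \<open>m = 0\<close> by (auto simp: irreducible_pairs_def dest!: spec[of _ t])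
  next
    case False
    then have "(4 :: 'a) \<noteq> 0"
      by (metis mult_2 numeral_Bit0 mult_eq_0_iff one_add_one distrib_right)
    define t where "t = m / 2"
    have m: "m = 2 * t"
      using False by (simp add: t_def)
    have "4 * (t ^ 2 - n) = 0"
      using eq by (simp add: m power_mult_distrib algebra_simps)
    then have "t ^ 2 = n"
      using \<open>4 \<noteq> 0\<close> by simp
    then have "t ^ 2 - m * t + n = 0"
      by (simp add: m power2_eq_square)
    then show False
      using assms by (auto simp: irreducible_pairs_def)
  qed
qed

text \<open>Putting two points of the axis into the equations of the chord shows that
  \<open>m'\<close> and 2 both annihilate the discriminant of \<open>(m', n')\<close>. It would
  therefore vanish, in characteristic 2 because \<open>m'\<close> is then 0 as well.\<close>

lemma conj_axis_neq_conj_chord: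
  fixes m n :: "'a::{field, finite}"
  assumes "(m, n) \<in> irreducible_pairs" "(m', n') \<in> irreducible_pairs"
  shows "conj_axis m n \<noteq> conj_chord m' n'"
proof
  assume "conj_axis m n = conj_chord m' n'"
  then have "quad_polar 1 m n 1 0 \<in> conj_chord m' n'" "quad_polar 1 m n 0 1 \<in> conj_chord m' n'"
    using quad_polar_in_conj_axis by blast+
  then have h: "3 * n = m' ^ 2 - n'" "m = m'"
    and h': "(m' ^ 2 - n') * m = m' * n' * 3" "n = m' * m - n' * 3"
    by (simp_all add: quad_polar_def conj_chord_def del: mult_cancel_left mult_cancel_right)
  have 1: "m' * (m' ^ 2 - 4 * n') = 0"
    using h(2) h'(1) by (simp add: algebra_simps)
  have 2: "2 * (m' ^ 2 - 4 * n') = 0"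
    using h h'(2) by (simp add: algebra_simps power2_eq_square)
  have "m' ^ 2 - 4 * n' = 0"
  proof (rule ccontr)
    assume "\<not> ?thesis"
    then have "m' = 0" "(2 :: 'a) = 0"
      using 1 2 by (simp_all only: mult_eq_0_iff simp_thms)
    then have "(4 :: 'a) = 0"
      by (metis mult_2 numeral_Bit0 add_0)
    with \<open>m' = 0\<close> \<open>\<not> ?thesis\<close> show False
      by simp
  qed
  then show False
    using irreducible_pairs_discriminant[OF assms(2)] by simp
qed

lemma inj_conj_chord: "inj (\<lambda>(m, n). conj_chord m n)"
proof (rule injI, clarify)
  fix m n m' n' :: 'a
  assume "conj_chord m n = conj_chord m' n'"
  moreover have "vector [m ^ 2 - n, m, 1, 0] \<in> conj_chord m n"
    by (simp add: conj_chord_def)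
  ultimately have "vector [m ^ 2 - n, m, 1, 0] \<in> conj_chord m' n'"
    by simp
  then show "m = m' \<and> n = n'"
    by (auto simp: conj_chord_def)
qed

lemma inj_conj_axis:
  assumes "(3 :: 'a::field) \<noteq> 0"
  shows "inj (\<lambda>(m, n :: 'a). conj_axis m n)"
proof (rule injI, clarify)
  fix m n m' n' :: 'a
  assume "conj_axis m n = conj_axis m' n'"
  then have "quad_polar 1 m n 1 0 \<in> conj_axis m' n'"
    using quad_polar_in_conj_axis by blast
  then show "m = m' \<and> n = n'"
    using assms by (auto simp: conj_axis_def quad_polar_def)
qed

text \<open>Counts the complement, covered by the sets \<open>A t\<close> of quadratics with root
  \<open>t\<close>. Each has q members, two distinct roots determine the quadratic, and no quadratic
  has three.\<close>

lemma card_irreducible_pairs: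
  "card (irreducible_pairs :: ('a::{field, finite} \<times> 'a) set) = CARD('a) choose 2"
proof -
  define A where "A t = {(m, n). t ^ 2 - m * t + n = (0 :: 'a)}" for t
  have card_A: "card (A t) = CARD('a)" for t
  proof -
    have "A t = (\<lambda>m. (m, m * t - t ^ 2)) ` UNIV"
      by (auto simp: A_def image_iff algebra_simps add_eq_0_iff2)
    then show ?thesis
      by (simp add: card_image inj_on_def)
  qed
  have two: "A s \<inter> A t = {(s + t, s * t)}" if "s \<noteq> t" for s t
  proof (intro equalityI subsetI)
    fix x assume "x \<in> A s \<inter> A t"
    then obtain m n where x: "x = (m, n)" and h: "s ^ 2 - m * s + n = 0" "t ^ 2 - m * t + n = 0"
      by (auto simp: A_def)
    then have "(s ^ 2 - m * s + n) - (t ^ 2 - m * t + n) = 0"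
      by simp
    then have "(s - t) * (s + t - m) = 0"
      by (simp add: algebra_simps power2_eq_square)
    then have "m = s + t"
      using that by simp
    then show "x \<in> {(s + t, s * t)}"
      using x h(1) by (simp add: algebra_simps power2_eq_square)
  qed (auto simp: A_def algebra_simps power2_eq_square)
  have "card (\<Union>t\<in>UNIV. A t) + (CARD('a) choose 2) = (\<Sum>t\<in>UNIV. card (A t))"
  proof (rule card_UN_pairs)
    fix r s t :: 'a
    assume "r \<noteq> s" "r \<noteq> t" "s \<noteq> t"
    then have "A r \<inter> A s \<inter> A t = {(r + s, r * s)} \<inter> {(r + t, r * t)}"
      using two[of r s] two[of r t] by blast
    then show "A r \<inter> A s \<inter> A t = {}"
      using \<open>s \<noteq> t\<close> by simp
  qed (auto simp: two)
  also have "\<dots> = card (UNIV :: ('a \<times> 'a) set)"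
    by (simp add: card_A)
  also have "(\<Union>t\<in>UNIV. A t) = - irreducible_pairs"
    by (auto simp: A_def irreducible_pairs_def)
  finally show ?thesis
    using card_Un_disjoint[of "- irreducible_pairs" "irreducible_pairs :: ('a \<times> 'a) set"]
      by (simp add: Compl_partition2)
qed

section \<open>Counting En-Gamma lines\<close>

lemma plane_Int_plane_in_proj_lines:
  fixes c d :: "'a::{field, finite} ^ 4"
  assumes "c \<noteq> 0" "\<not> plane c \<subseteq> plane d"
  shows "plane c \<inter> plane d \<in> proj_lines"
proof -
  have "CARD('a) * card (plane c \<inter> plane d) = CARD('a) * CARD('a) ^ 2"
    using card_Int_plane[OF subspace_plane assms(2)] card_plane[OF assms(1)]
    by (simp add: power2_eq_square power3_eq_cube)
  then have "card (plane c \<inter> plane d) = CARD('a) ^ 2"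
    by simp
  then show ?thesis
    by (simp add: proj_lines_iff subspace_plane vec.subspace_inter)
qed

lemma proj_lines_eq_subset:
  fixes l m :: "('a::{field, finite} ^ 4) set"
  shows "l \<in> proj_lines \<Longrightarrow> m \<in> proj_lines \<Longrightarrow> l \<subseteq> m \<Longrightarrow> l = m"
  by (intro card_subset_eq) (auto simp: proj_lines_iff)

lemma osc_Int_osc_in_proj_lines:
  fixes j k :: "'a::{field, finite} option"
  assumes "j \<noteq> k"
  shows "plane (osc_form j) \<inter> plane (osc_form k) \<in> proj_lines"
proof (rule plane_Int_plane_in_proj_lines[OF osc_form_nonzero])
  show "\<not> plane (osc_form j) \<subseteq> plane (osc_form k)"
    using assms cubic_pt_mem_osc_form[of j j] cubic_pt_mem_osc_form[of j k] by blast
qed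

lemma double_Int_osc_in_proj_lines:
  fixes a b k :: "'a::{field, finite} option"
  assumes "a \<noteq> b"
  shows "plane (double_form a b) \<inter> plane (osc_form k) \<in> proj_lines"
proof (rule plane_Int_plane_in_proj_lines[OF double_form_nonzero])
  show "\<not> plane (double_form a b) \<subseteq> plane (osc_form k)"
    using assms cubic_pt_mem_double_form[of a a b] cubic_pt_mem_double_form[of b a b]
        cubic_pt_mem_osc_form[of a k] cubic_pt_mem_osc_form[of b k]
    by blast
qed

lemma osc_Int_osc_not_in_double_form:
  assumes "j \<noteq> k" "a \<noteq> b"
  shows "\<not> plane (osc_form j) \<inter> plane (osc_form k) \<subseteq> plane (double_form a b)"
proof
  assume sub: "plane (osc_form j) \<inter> plane (osc_form k) \<subseteq> plane (double_form a b)"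
  have "root_polar j k i \<in> plane (osc_form j) \<inter> plane (osc_form k)" for i
    by (simp add: mem_plane dot_osc_form_root_polar)
  then have "root_polar j k i \<in> plane (double_form a b)" for i
    using sub by blast
  then have "dot (double_form a b) (root_polar j k i) = 0" for i
    by (simp only: mem_plane)
  \<comment> \<open>The point with \<open>i = a\<close> forces \<open>j\<close> or \<open>k\<close>
    to equal \<open>a\<close>; the point with \<open>i = b\<close> then forces the other one to
    equal \<open>a\<close> too, against \<open>j \<noteq> k\<close>.\<close>
  from this[of a] this[of b] show False
    using assms by (auto simp: dot_double_form_root_polar)
qed

lemma no_axis_in_two_C_plane:
  assumes "p \<in> two_C_planes" "l \<in> real_axes \<union> imaginary_axes"
  shows "\<not> l \<subseteq> p"
proof -
  obtain a b where p: "p = plane (double_form a b)" "a \<noteq> b"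
    using assms(1) by (auto simp: two_C_planes_eq)
  from assms(2) show ?thesis
  proof
    assume "l \<in> real_axes"
    then obtain j k where "l = plane (osc_form j) \<inter> plane (osc_form k)" "j \<noteq> k"
      by (auto simp: real_axes_def Gamma_planes_eq)
    then show ?thesis
      using osc_Int_osc_not_in_double_form p by simp
  next
    assume "l \<in> imaginary_axes"
    then show ?thesis
      using conj_axis_not_in_double_form p by (auto simp: imaginary_axes_eq)
  qed
qed

section \<open>Sizes of the classes of lines\<close>

definition incident_lines :: "('a::{field, finite} ^ 4) set set" where
  "incident_lines = (\<Union>k. {l \<in> proj_lines. cubic_pt k \<in> l})"

text \<open>The osculating plane at \<open>k\<close> has no other point on the cubic, so omitting
  the lines through \<open>cubic_pt k\<close> makes the class disjoint from
  \<open>incident_lines\<close>.\<close>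

definition osc_lines :: "'a::{field, finite} option \<Rightarrow> ('a ^ 4) set set" where
  "osc_lines k = {l \<in> proj_lines. l \<subseteq> plane (osc_form k) \<and> cubic_pt k \<notin> l}"

lemma EnGamma_iff:
  fixes l :: "('a::{field, finite} ^ 4) set"
  shows "l \<in> EnGamma_lines \<longleftrightarrow> l \<in> proj_lines \<and> (\<forall>k. cubic_pt k \<notin> l) \<and>
    (\<forall>k. \<not> l \<subseteq> plane (osc_form k)) \<and> l \<notin> imaginary_chords \<and> ((3 :: 'a) \<noteq> 0 \<longrightarrow> l \<notin> imaginary_axes)"
proof (cases "l \<in> proj_lines")
  case True
  then have "proj_point x \<subseteq> l \<longleftrightarrow> x \<in> l" for x
    by (simp add: proj_point_subset_iff proj_lines_def)
  then show ?thesis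
    unfolding EnGamma_lines_def three_eq_0_iff by (auto simp: twisted_cubic_eq Gamma_planes_eq)
qed (simp add: EnGamma_lines_def)

lemma lines_through_two_points:
  fixes j k :: "'a::{field, finite} option"
  assumes "j \<noteq> k"
  shows "{l \<in> proj_lines. cubic_pt j \<in> l \<and> cubic_pt k \<in> l} = {vec.span {cubic_pt j, cubic_pt k}}"
  using span_in_proj_lines[OF cubic_pt_nonzero cubic_pt_not_in_span, of k j] assms
    proj_line_eq_span[OF _ _ _ cubic_pt_nonzero cubic_pt_not_in_span, of _ j k]
  by (auto intro: vec.span_base)

lemma line_through_three_points:
  fixes i j k :: "'a::{field, finite} option"
  assumes "i \<noteq> j" "k \<noteq> i" "k \<noteq> j" "l \<in> proj_lines" "cubic_pt i \<in> l" "cubic_pt j \<in> l"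
  shows "cubic_pt k \<notin> l"
proof -
  have "l = vec.span {cubic_pt i, cubic_pt j}"
    using assms cubic_pt_not_in_span[of j i]
      by (intro proj_line_eq_span) (auto simp: cubic_pt_nonzero)
  \<comment> \<open>This plane contains the two points and no third point of the cubic.\<close>
  also have "\<dots> \<subseteq> plane (double_form i j)"
    by (intro vec.span_minimal subspace_plane) auto
  finally show ?thesis
    using assms by auto
qed

lemma card_incident_lines:
  "card (incident_lines :: ('a::{field, finite} ^ 4) set set) + (CARD('a) + 1 choose 2) =
    (CARD('a) + 1) * (CARD('a) ^ 2 + CARD('a) + 1)"
proof -
  have "card (\<Union>k\<in>(UNIV :: 'a option set). {l \<in> proj_lines. cubic_pt k \<in> l}) +
      (CARD('a option) choose 2) =
      (\<Sum>k\<in>(UNIV :: 'a option set). card {l \<in> proj_lines. cubic_pt k \<in> l})"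
  proof (rule card_UN_pairs)
    fix j k :: "'a option"
    assume "j \<noteq> k"
    have "{l \<in> proj_lines. cubic_pt j \<in> l} \<inter> {l \<in> proj_lines. cubic_pt k \<in> l} =
        {l \<in> proj_lines. cubic_pt j \<in> l \<and> cubic_pt k \<in> l}"
      by auto
    then show "card ({l \<in> proj_lines. cubic_pt j \<in> l} \<inter> {l \<in> proj_lines. cubic_pt k \<in> l}) = 1"
      by (simp add: lines_through_two_points[OF \<open>j \<noteq> k\<close>])
  next
    fix i j k :: "'a option"
    assume "i \<noteq> j" "i \<noteq> k" "j \<noteq> k"
    then show "{l \<in> proj_lines. cubic_pt i \<in> l} \<inter> {l \<in> proj_lines. cubic_pt j \<in> l} \<inter>
        {l \<in> proj_lines. cubic_pt k \<in> l} = {}"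
      using line_through_three_points[of i j k] by auto
  qed auto
  then show ?thesis
    by (simp add: incident_lines_def card_lines_through_point cubic_pt_nonzero)
qed

lemma card_osc_lines: "card (osc_lines k :: ('a::{field, finite} ^ 4) set set) = CARD('a) ^ 2"
proof -
  have "osc_lines k = {l \<in> proj_lines. l \<subseteq> plane (osc_form k)} -
      {l \<in> proj_lines. cubic_pt k \<in> l \<and> l \<subseteq> plane (osc_form k)}"
    by (auto simp: osc_lines_def)
  then have "card (osc_lines k) = card {l \<in> proj_lines. l \<subseteq> plane (osc_form k)} -
      card {l \<in> proj_lines. cubic_pt k \<in> l \<and> l \<subseteq> plane (osc_form k)}"
    by (simp add: card_Diff_subset subset_eq)
  then show ?thesis
    by (simp add: card_lines_in_plane[OF osc_form_nonzero]
        card_lines_through_in_plane[OF osc_form_nonzero _ cubic_pt_nonzero])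
qed

lemma osc_lines_Int:
  fixes j k :: "'a::{field, finite} option"
  assumes "j \<noteq> k"
  shows "osc_lines j \<inter> osc_lines k = {plane (osc_form j) \<inter> plane (osc_form k)}"
proof -
  let ?m = "plane (osc_form j) \<inter> plane (osc_form k)"
  have m: "?m \<in> proj_lines"
    by (rule osc_Int_osc_in_proj_lines) fact
  then have "l = ?m" if "l \<in> osc_lines j \<inter> osc_lines k" for l
    using that by (intro proj_lines_eq_subset) (auto simp: osc_lines_def)
  moreover have "?m \<in> osc_lines j \<inter> osc_lines k"
    using m assms by (simp add: osc_lines_def)
  ultimately show ?thesis
    by blast
qed

lemma card_osc_lines_Un:
  assumes "(3 :: 'a::{field, finite}) \<noteq> 0"
  shows "card (\<Union>k :: 'a option. osc_lines k) + (CARD('a) + 1 choose 2) =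
      (CARD('a) + 1) * CARD('a) ^ 2"
proof -
  have "card (\<Union>k\<in>(UNIV :: 'a option set). osc_lines k) + (CARD('a option) choose 2) =
      (\<Sum>k\<in>(UNIV :: 'a option set). card (osc_lines k))"
  proof (rule card_UN_pairs)
    fix i j k :: "'a option"
    assume ne: "i \<noteq> j" "i \<noteq> k" "j \<noteq> k"
    \<comment> \<open>With 3 invertible and \<open>h\<close>, \<open>i\<close>, \<open>j\<close> all
      different from \<open>k\<close>, the point \<open>root_polar i j h\<close> of the axis escapes
      the third plane, so no line lies in three osculating planes.\<close>
    obtain h where "h \<noteq> k"
      using ne(2) by blast
    then have "root_polar i j h \<in> plane (osc_form i) \<inter> plane (osc_form j)"
        "root_polar i j h \<notin> plane (osc_form k)"
      using assms ne by (auto simp: mem_plane dot_osc_form_root_polar)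
    then have "plane (osc_form i) \<inter> plane (osc_form j) \<notin> osc_lines k"
      by (auto simp: osc_lines_def)
    then show "osc_lines i \<inter> osc_lines j \<inter> osc_lines k = {}"
      using osc_lines_Int[OF ne(1)] by simp
  qed (auto simp: osc_lines_Int)
  then show ?thesis
    by (simp add: card_osc_lines)
qed

lemma osc_planes_pencil:
  assumes "(3 :: 'a::{field, finite}) = 0" "j \<noteq> (k :: 'a option)"
  shows "plane (osc_form j) \<inter> plane (osc_form k) = {x. x $ 1 = 0 \<and> x $ 4 = 0}" (is "_ = ?X")
proof (rule proj_lines_eq_subset[symmetric])
  \<comment> \<open>In characteristic 3 the middle coefficients vanish, so all osculating planes
    contain the line given by zero first and last coordinate.\<close>
  have osc_form: "x \<in> plane (osc_form i) \<longleftrightarrow> hom_v i ^ 3 * x $ 1 = hom_u i ^ 3 * x $ 4"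
    for x and i :: "'a option"
    using assms(1) by (simp add: mem_plane dot_def osc_form_def)
  show "plane (osc_form j) \<inter> plane (osc_form k) \<in> proj_lines"
    by (rule osc_Int_osc_in_proj_lines) fact
  show "?X \<subseteq> plane (osc_form j) \<inter> plane (osc_form k)"
    by (auto simp: osc_form)
  have "bij_betw (\<lambda>(y, z). vector [0, y, z, 0]) UNIV ?X"
    by (rule bij_betwI[where g = "\<lambda>x :: 'a ^ 4. (x $ 2, x $ 3)"]) (auto simp: vec4_eq_iff)
  from bij_betw_same_card[OF this] have "card ?X = CARD('a) ^ 2"
    by (simp add: power2_eq_square)
  then show "?X \<in> proj_lines"
    by (simp add: proj_lines_iff vec.subspace_def)
qed

text \<open>The classes \<open>osc_lines k\<close> share exactly the line \<open>ax\<close>. Apart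
  from it they are disjoint with q^2 - 1 lines each, and the final 1 counts \<open>ax\<close>
  once.\<close>

lemma card_osc_lines_Un_3:
  assumes "(3 :: 'a::{field, finite}) = 0"
  shows "card (\<Union>k :: 'a option. osc_lines k) = (CARD('a) + 1) * (CARD('a) ^ 2 - 1) + 1"
proof -
  define ax where "ax = {x :: 'a ^ 4. x $ 1 = 0 \<and> x $ 4 = 0}"
  have Int: "osc_lines j \<inter> osc_lines k = {ax}" if "j \<noteq> k" for j k :: "'a option"
    using osc_lines_Int[OF that] osc_planes_pencil[OF assms that] by (simp add: ax_def)
  have ax: "ax \<in> osc_lines k" for k
  proof -
    obtain j where "j \<noteq> k"
      using exists_not_mem[of k k] one_less_CARD_field[where ?'a = 'a] by auto
    then show ?thesis
      using Int by blast
  qed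
  have "(\<Union>k. osc_lines k) = insert ax (\<Union>k. osc_lines k - {ax})"
    using ax by blast
  then have "card (\<Union>k :: 'a option. osc_lines k) = card (insert ax (\<Union>k. osc_lines k - {ax}))"
    by (rule arg_cong)
  also have "\<dots> = Suc (card (\<Union>k. osc_lines k - {ax}))"
    by (rule card_insert_disjoint) (rule finite, blast)
  also have "card (\<Union>k. osc_lines k - {ax}) = (\<Sum>k\<in>UNIV. card (osc_lines k - {ax}))"
  proof (intro card_UN_disjoint ballI impI)
    show "(osc_lines j - {ax}) \<inter> (osc_lines k - {ax}) = {}" if "j \<noteq> k" for j k :: "'a option"
      using Int[OF that] by blast
  qed simp_all
  also have "\<dots> = (\<Sum>k\<in>(UNIV :: 'a option set). CARD('a) ^ 2 - 1)"
    by (intro sum.cong refl) (simp add: card_Diff_singleton[OF ax] card_osc_lines)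
  finally show ?thesis
    by simp
qed

text \<open>Imaginary chords and axes miss the cubic and lie in no osculating plane, and no axis is
  a chord. Taking \<open>A\<close> empty in characteristic 3 gives one equation for both
  cases.\<close>

lemma card_proj_lines_partition:
  fixes A :: "('a::{field, finite} ^ 4) set set"
  defines "A \<equiv> if (3 :: 'a) = 0 then {} else imaginary_axes"
  shows "card (EnGamma_lines :: ('a ^ 4) set set) + card (incident_lines :: ('a ^ 4) set set) +
    card (\<Union>k :: 'a option. osc_lines k) + card (imaginary_chords :: ('a ^ 4) set set) + card A =
    card (proj_lines :: ('a ^ 4) set set)"
proof -
  let ?E = "EnGamma_lines :: ('a ^ 4) set set" and ?S = "incident_lines :: ('a ^ 4) set set"
    and ?G = "\<Union>k :: 'a option. osc_lines k" and ?C = "imaginary_chords :: ('a ^ 4) set set"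
  have C: "l \<in> ?C \<Longrightarrow> l \<in> proj_lines \<and> (\<forall>k. cubic_pt k \<notin> l) \<and> (\<forall>k. \<not> l \<subseteq> plane (osc_form k))" for l
    by (auto simp: imaginary_chords_eq conj_chord_in_proj_lines dest: cubic_pt_not_in_conj_chord
        conj_chord_not_in_osc_form)
  have A: "l \<in> A \<Longrightarrow> l \<in> proj_lines \<and> (\<forall>k. cubic_pt k \<notin> l) \<and> (\<forall>k. \<not> l \<subseteq> plane (osc_form k)) \<and>
      l \<notin> ?C" for l
    by (auto simp: imaginary_axes_eq imaginary_chords_eq A_def conj_axis_in_proj_lines
        split: if_splits dest: cubic_pt_not_in_conj_axis conj_axis_not_in_osc_form conj_axis_neq_conj_chord)
  have E: "l \<in> ?E \<longleftrightarrow> l \<in> proj_lines \<and> (\<forall>k. cubic_pt k \<notin> l) \<and> (\<forall>k. \<not> l \<subseteq> plane (osc_form k)) \<and>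
      l \<notin> ?C \<and> l \<notin> A" for l
    by (auto simp: EnGamma_iff A_def)
  have S: "l \<in> ?S \<longleftrightarrow> l \<in> proj_lines \<and> (\<exists>k. cubic_pt k \<in> l)" for l
    by (auto simp: incident_lines_def)
  have G: "l \<in> ?G \<longleftrightarrow> l \<in> proj_lines \<and> (\<forall>k. cubic_pt k \<notin> l) \<and> (\<exists>k. l \<subseteq> plane (osc_form k))" for l
    using cubic_pt_mem_osc_form by (auto simp: osc_lines_def)
  have un: "proj_lines = (((?E \<union> ?S) \<union> ?G) \<union> ?C) \<union> A"
  proof (rule Set.set_eqI)
    show "l \<in> proj_lines \<longleftrightarrow> l \<in> (((?E \<union> ?S) \<union> ?G) \<union> ?C) \<union> A" for l
      unfolding Un_iff using C[of l] A[of l] E[of l] S[of l] G[of l] by blast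
  qed
  have "\<not> (l \<in> ?E \<and> l \<in> ?S) \<and> \<not> ((l \<in> ?E \<or> l \<in> ?S) \<and> l \<in> ?G) \<and>
      \<not> ((l \<in> ?E \<or> l \<in> ?S \<or> l \<in> ?G) \<and> l \<in> ?C) \<and>
      \<not> ((l \<in> ?E \<or> l \<in> ?S \<or> l \<in> ?G \<or> l \<in> ?C) \<and> l \<in> A)" for l
    using C[of l] A[of l] E[of l] S[of l] G[of l] by blast
  then have disj: "?E \<inter> ?S = {}" "(?E \<union> ?S) \<inter> ?G = {}" "((?E \<union> ?S) \<union> ?G) \<inter> ?C = {}"
    "(((?E \<union> ?S) \<union> ?G) \<union> ?C) \<inter> A = {}"
    unfolding disjoint_iff Un_iff by blast+
  show ?thesis
    unfolding un by (simp only: disj[THEN card_Un_disjoint[OF finite finite]])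
qed

lemma card_EnGamma_lines:
  "card (EnGamma_lines :: ('a::{field, finite} ^ 4) set set) =
    (CARD('a) + 1) * CARD('a) * (CARD('a) - 1) ^ 2"
proof -
  let ?q = "CARD('a)"
  obtain r where r: "?q = Suc r"
    using one_less_CARD_field[where ?'a = 'a] by (cases ?q) auto
  define e where "e = card (EnGamma_lines :: ('a ^ 4) set set)"
  define s where "s = card (incident_lines :: ('a ^ 4) set set)"
  define g where "g = card (\<Union>k :: 'a option. osc_lines k)"
  \<comment> \<open>The binomial coefficient is kept as an unknown; it cancels between the counts in
    both cases.\<close>
  define c where "c = ?q choose 2"
  have c': "?q + 1 choose 2 = c + ?q"
    by (simp add: c_def numeral_2_eq_2)
  have chords: "card (imaginary_chords :: ('a ^ 4) set set) = c"
    using inj_conj_chord[where ?'a = 'a]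
    by (simp add: imaginary_chords_eq card_image[OF inj_on_subset] card_irreducible_pairs c_def)
  have s: "s + (c + ?q) = (?q + 1) * (?q ^ 2 + ?q + 1)"
    using card_incident_lines[where ?'a = 'a] unfolding c' s_def .
  have "e = (?q + 1) * ?q * (?q - 1) ^ 2"
  proof (cases "(3 :: 'a) = 0")
    case True
    have "e + s + g + c = (?q ^ 2 + 1) * (?q ^ 2 + ?q + 1)"
      using card_proj_lines_partition[where ?'a = 'a] True
      by (simp only: chords card_proj_lines e_def s_def g_def if_True card.empty add_0_right
          simp_thms)
    moreover have "g = (?q + 1) * (?q ^ 2 - 1) + 1"
      using card_osc_lines_Un_3[OF True] by (simp add: g_def)
    ultimately show ?thesis
      using s unfolding r by (simp add: algebra_simps power2_eq_square)
  next
    case False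
    have "card (imaginary_axes :: ('a ^ 4) set set) = c"
      using inj_conj_axis[OF False]
      by (simp add: imaginary_axes_eq card_image[OF inj_on_subset] card_irreducible_pairs c_def)
    then have "e + s + g + c + c = (?q ^ 2 + 1) * (?q ^ 2 + ?q + 1)"
      using card_proj_lines_partition[where ?'a = 'a] False
      by (simp only: chords card_proj_lines e_def s_def g_def if_False simp_thms)
    moreover have "g + (c + ?q) = (?q + 1) * ?q ^ 2"
      using card_osc_lines_Un[OF False] unfolding c' g_def .
    ultimately show ?thesis
      using s unfolding r by (simp add: algebra_simps power2_eq_square)
  qed
  then show ?thesis
    by (simp add: e_def)
qed

section \<open>The count in one plane and the average\<close>

lemma Lambda_num_EnGamma:
  fixes p :: "('a::{field, finite} ^ 4) set"
  assumes "p \<in> two_C_planes"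
  shows "Lambda_num EnGamma_lines p = (CARD('a) - 1) ^ 2"
proof -
  let ?q = "CARD('a)"
  obtain a b where p: "p = plane (double_form a b)" and ab: "a \<noteq> b"
    using assms by (auto simp: two_C_planes_eq)
  define L where "L = {l \<in> proj_lines. l \<subseteq> p}"
  define Ta where "Ta = {l \<in> proj_lines. cubic_pt a \<in> l \<and> l \<subseteq> p}"
  define Tb where "Tb = {l \<in> proj_lines. cubic_pt b \<in> l \<and> l \<subseteq> p}"
  \<comment> \<open>The parameters \<open>a\<close> and \<open>b\<close> are left out because their
    osculating planes cut \<open>p\<close> in lines through the points of the cubic, already in
    \<open>Ta\<close> or \<open>Tb\<close>.\<close>
  define D where "D = (\<lambda>k. p \<inter> plane (osc_form k)) ` (- {a, b})"
  have line: "p \<inter> plane (osc_form k) \<in> proj_lines" for k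
    unfolding p by (rule double_Int_osc_in_proj_lines[OF ab])
  have L: "card L = ?q ^ 2 + ?q + 1"
    unfolding L_def p by (rule card_lines_in_plane[OF double_form_nonzero])
  have "card Ta = ?q + 1" "card Tb = ?q + 1"
    unfolding Ta_def Tb_def p
    by (rule card_lines_through_in_plane[OF double_form_nonzero _ cubic_pt_nonzero]; simp)+
  moreover have "Ta \<inter> Tb = {vec.span {cubic_pt a, cubic_pt b}}"
  proof -
    have "vec.span {cubic_pt a, cubic_pt b} \<subseteq> p"
      unfolding p by (intro vec.span_minimal subspace_plane) auto
    then show ?thesis
      using lines_through_two_points[OF ab] unfolding Ta_def Tb_def by blast
  qed
  ultimately have T: "card (Ta \<union> Tb) = 2 * ?q + 1"
    using card_Un_Int[of Ta Tb] by simp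
  have "inj_on (\<lambda>k. p \<inter> plane (osc_form k)) (- {a, b})"
  proof (rule inj_onI, rule ccontr)
    fix j k
    assume eq: "p \<inter> plane (osc_form j) = p \<inter> plane (osc_form k)" and "j \<noteq> k"
    \<comment> \<open>A line cut out by two osculating planes would be a real axis inside
      \<open>p\<close>.\<close>
    then have "p \<inter> plane (osc_form j) = plane (osc_form j) \<inter> plane (osc_form k)"
      by (intro proj_lines_eq_subset line osc_Int_osc_in_proj_lines) auto
    then show False
      using osc_Int_osc_not_in_double_form[OF \<open>j \<noteq> k\<close> ab] p by blast
  qed
  then have "card D = card (- {a, b})"
    unfolding D_def by (rule card_image)
  then have D: "card D = ?q - 1"
    using ab by (simp add: Compl_eq_Diff_UNIV card_Diff_subset)
  have "{l \<in> EnGamma_lines. l \<subseteq> p} = L - (Ta \<union> Tb) - D"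
  proof (intro equalityI subsetI)
    fix l assume "l \<in> {l \<in> EnGamma_lines. l \<subseteq> p}"
    then show "l \<in> L - (Ta \<union> Tb) - D"
      by (auto simp: EnGamma_iff L_def Ta_def Tb_def D_def)
  next
    fix l assume l: "l \<in> L - (Ta \<union> Tb) - D"
    then have lp: "l \<in> proj_lines" "l \<subseteq> p" "cubic_pt a \<notin> l" "cubic_pt b \<notin> l"
      by (auto simp: L_def Ta_def Tb_def)
    have "cubic_pt k \<notin> l" for k
      using lp cubic_pt_mem_double_form[of k a b] p by auto
    moreover have "\<not> l \<subseteq> plane (osc_form k)" for k
    proof
      assume "l \<subseteq> plane (osc_form k)"
      then have eq: "l = p \<inter> plane (osc_form k)"
        using lp by (intro proj_lines_eq_subset line) auto
      then have "k \<noteq> a" "k \<noteq> b"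
        using lp p by auto
      then show False
        using eq l by (auto simp: D_def)
    qed
    moreover have "l \<notin> imaginary_chords"
      using conj_chord_not_in_double_form lp(2) p by (auto simp: imaginary_chords_eq)
    moreover have "l \<notin> imaginary_axes"
      using no_axis_in_two_C_plane[OF assms] lp(2) by auto
    ultimately show "l \<in> {l \<in> EnGamma_lines. l \<subseteq> p}"
      using lp by (simp add: EnGamma_iff)
  qed
  moreover have "D \<subseteq> L - (Ta \<union> Tb)" "Ta \<union> Tb \<subseteq> L"
    using line p by (auto simp: D_def L_def Ta_def Tb_def)
  ultimately have "card {l \<in> EnGamma_lines. l \<subseteq> p} = ?q ^ 2 + ?q + 1 - (2 * ?q + 1) - (?q - 1)"
    by (simp add: card_Diff_subset L T D)
  also have "\<dots> = (?q - 1) ^ 2"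
  proof -
    obtain r where "?q = Suc r"
      using one_less_CARD_field[where ?'a = 'a] by (cases ?q) auto
    then show ?thesis
      by (simp add: power2_eq_square)
  qed
  finally show ?thesis
    by (simp add: Lambda_num_def)
qed

theorem theorem5p6:
  fixes q :: nat
  assumes "CARD('a::{field, finite}) = q" and "q \<ge> 5"
  shows
    "(q mod 3 \<noteq> 0 \<longrightarrow>
        (\<forall>p \<in> (two_C_planes :: ('a ^ 4) set set). \<forall>l \<in> real_axes \<union> imaginary_axes. \<not> l \<subseteq> p) \<and>
        (\<forall>p \<in> (two_C_planes :: ('a ^ 4) set set). Lambda_num real_axes p = 0) \<and>
        Pi_avg (two_C_planes :: ('a ^ 4) set set) real_axes = 0 \<and>
        (\<forall>p \<in> (two_C_planes :: ('a ^ 4) set set). Lambda_num imaginary_axes p = 0) \<and>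
        Pi_avg (two_C_planes :: ('a ^ 4) set set) imaginary_axes = 0) \<and>
     (\<forall>p \<in> (two_C_planes :: ('a ^ 4) set set). Lambda_num EnGamma_lines p = (q - 1) ^ 2) \<and>
     Pi_avg (two_C_planes :: ('a ^ 4) set set) EnGamma_lines = 1"
proof -
  let ?T = "two_C_planes :: ('a ^ 4) set set" and ?E = "EnGamma_lines :: ('a ^ 4) set set"
  have no: "\<forall>p \<in> ?T. \<forall>l \<in> real_axes \<union> imaginary_axes. \<not> l \<subseteq> p"
    using no_axis_in_two_C_plane by blast
  have Lambda0: "\<forall>p \<in> ?T. Lambda_num L p = 0" and Pi0: "Pi_avg ?T L = 0"
    if "L \<subseteq> real_axes \<union> imaginary_axes" for L
  proof -
    have "{l \<in> L. l \<subseteq> p} = {}" if "p \<in> ?T" for p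
      using no \<open>L \<subseteq> _\<close> that by blast
    then show "\<forall>p \<in> ?T. Lambda_num L p = 0"
      by (simp add: Lambda_num_def)
    have "{p \<in> ?T. l \<subseteq> p} = {}" if "l \<in> L" for l
      using no \<open>L \<subseteq> _\<close> that by blast
    then have "card {p \<in> ?T. l \<subseteq> p} = 0" if "l \<in> L" for l
      using that by simp
    then have "(\<Sum>l\<in>L. real (card {p \<in> ?T. l \<subseteq> p})) = 0"
      by (intro sum.neutral ballI) (simp only: of_nat_0)
    then show "Pi_avg ?T L = 0"
      by (simp only: Pi_avg_def div_0)
  qed
  have Lambda: "\<forall>p \<in> ?T. Lambda_num ?E p = (q - 1) ^ 2"
    using Lambda_num_EnGamma assms(1) by blast
  \<comment> \<open>Double counting of incident pairs. There are (q + 1) q planes with (q - 1)^2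
    lines each, which is the total number of En Gamma-lines, so the average is 1.\<close>
  have "(\<Sum>l\<in>?E. card {p \<in> ?T. l \<subseteq> p}) = (q - 1) ^ 2 * card ?T"
    using Lambda by (intro sum_multicount) (auto simp: Lambda_num_def)
  also have "\<dots> = card ?E"
    using assms(1) by (simp add: card_two_C_planes card_EnGamma_lines mult_ac)
  finally have "(\<Sum>l\<in>?E. real (card {p \<in> ?T. l \<subseteq> p})) = real (card ?E)"
    by (simp flip: of_nat_sum)
  \<comment> \<open>Division by zero yields 0, so the quotient is 1 only for a non-empty
    class.\<close>
  moreover have "card ?E \<noteq> 0"
    using assms by (simp add: card_EnGamma_lines)
  ultimately have "Pi_avg ?T ?E = 1"
    by (simp add: Pi_avg_def)
  then show ?thesis
    using no Lambda0[of real_axes] Lambda0[of imaginary_axes] Pi0[of real_axes] Pi0[of imaginary_axes] Lambda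
    by simp
qed

end
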